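(* Let $\delta\in\{1,2\}$. Then every nonnegative integer $n$ can be written as $p_5(w)+p_5(x)+2p_5(y)+3\delta\, p_5(z)$ with $w,x,y,z$ nonnegative integers.
   Context: For $k\in\mathbb{Z}$, $p_5(k)=k(3k-1)/2$ (pentagonal numbers when $k\ge 0$). *)

theory Defs
  imports Main
begin

definition p5 :: "int \<Rightarrow> int" where
  "p5 k = k * (3 * k - 1) div 2"

end

theory Submission
  imports Defs "HOL-Analysis.Summation_Tests" "HOL-Number_Theory.Quadratic_Reciprocity"
begin

text \<open>
  Put \<open>a = w\<^sup>2 + x\<^sup>2 + 2 * y\<^sup>2 + c * z\<^sup>2\<close> and \<open>b = w + x + 2 * y + c * z\<close> with \<open>c = 3\<close> or \<open>c = 6\<close>; then
  \<open>n\<close> is the required sum iff \<open>3 * a = 2 * n + b\<close>, and as in Cauchy's proof of the polygonal number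
  theorem all variables are nonnegative once \<open>b\<^sup>2\<close> is close to its maximum \<open>(4 + c) * a\<close>. For
  large \<open>n\<close> there is such a \<open>b\<close> in a prescribed residue class, and one has to solve the two equations
  for given \<open>a\<close> and \<open>b\<close>. This is a representation problem for a ternary form whose quaternion
  algebra ramifies only at 7 (resp. 5) and infinity, and it reduces to representing \<open>7 * K\<close> by
  \<open>x\<^sup>2 + x * z + 2 * z\<^sup>2 + y\<^sup>2\<close>, resp. \<open>5 * K\<close> by \<open>x\<^sup>2 + y\<^sup>2 + 2 * z\<^sup>2 + x * y + x * z + y * z\<close>, where \<open>- K\<close> is a
  nonresidue. These forms are the only reduced ones of their discriminant up to equivalence, so it suffices
  to produce any positive form of that discriminant representing \<open>q * K\<close>; it is glued
  from \<open>q * K\<close> and a binary form of determinant \<open>K\<close> in a suitable genus. The existence of the genus is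
  shown without Dirichlet's theorem: if it were empty, some real character would be trivial on all
  primes split by the discriminant character, which the hyperbola method excludes.
\<close>

section \<open>Real characters\<close>

text \<open>Local solvability only yields a representation by some class of the genus; this is why
  uniqueness of the reduced form matters. The number represented is \<open>q * K\<close> rather than
  \<open>K\<close> because modulo \<open>q\<close> both forms are anisotropic up to their radical:
  the vectors with value divisible by \<open>q\<close> form a sublattice, and the form divided by
  \<open>q\<close> on it leads to the deficit \<open>(4 + c) * a - b\<^sup>2\<close> after a further
  step at 3 when \<open>c = 3\<close> and at 2 when \<open>c = 6\<close>. Dirichlet's theorem can be
  avoided because the coefficient \<open>m\<close> of the glued form may be composite: a product of
  distinct primes modulo which \<open>- K\<close> is a square serves as well as a prime, and its
  residue matters only up to squares, so only real characters occur. The thresholds 3000 and 70000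
  come from the window for \<open>b\<close> (for half the linear sum when \<open>c = 6\<close>),
  whose width is about \<open>0.16 * sqrt n\<close> resp. \<open>0.066 * sqrt n\<close> and which
  must hold 6 resp. 18 consecutive integers.\<close>

definition real_character :: "int \<Rightarrow> (int \<Rightarrow> int) \<Rightarrow> bool" where
  "real_character M \<phi> \<longleftrightarrow> M > 0 \<and> (\<forall>a b. \<phi> (a * b) = \<phi> a * \<phi> b) \<and> (\<forall>a. \<phi> (a mod M) = \<phi> a) \<and>
     (\<forall>a. \<phi> a \<in> {-1, 0, 1}) \<and> (\<forall>a. \<phi> a = 0 \<longleftrightarrow> \<not> coprime a M)"

lemma real_characterD:
  assumes "real_character M \<phi>"
  shows "M > 0" "\<phi> (a * b) = \<phi> a * \<phi> b" "\<phi> (a mod M) = \<phi> a" "\<phi> a \<in> {-1, 0, 1}"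
    "\<phi> a = 0 \<longleftrightarrow> \<not> coprime a M"
  using assms unfolding real_character_def by blast+

lemma real_character_abs_le: "real_character M \<phi> \<Longrightarrow> \<bar>\<phi> a\<bar> \<le> 1"
  using real_characterD(4)[of M \<phi> a] by auto

lemma real_character_cong:
  assumes "real_character M \<phi>" "[a = b] (mod M)"
  shows "\<phi> a = \<phi> b"
  using assms real_characterD(3)[OF assms(1)] by (metis cong_def)

lemma real_character_1:
  assumes "real_character M \<phi>"
  shows "\<phi> 1 = 1"
proof -
  have "\<phi> 1 = \<phi> 1 * \<phi> 1" using real_characterD(2)[OF assms, of 1 1] by simp
  moreover have "\<phi> 1 \<noteq> 0" using real_characterD(5)[OF assms, of 1] by simp
  ultimately show ?thesis by auto
qed

lemma real_character_power:
  assumes "real_character M \<phi>"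
  shows "\<phi> (a ^ k) = \<phi> a ^ k"
  by (induction k) (simp_all add: real_character_1[OF assms] real_characterD(2)[OF assms])

lemma real_character_mult:
  assumes "real_character M \<phi>" "real_character M \<psi>"
  shows "real_character M (\<lambda>a. \<phi> a * \<psi> a)"
proof -
  have "\<phi> a * \<psi> a \<in> {-1, 0, 1}" for a
    using real_characterD(4)[OF assms(1), of a] real_characterD(4)[OF assms(2), of a] by auto
  thus ?thesis
    using assms unfolding real_character_def by simp
qed

text \<open>A value \<open>-1\<close> certifies that \<phi> is not principal; multiplication by
  \<open>r\<close> permutes the residues modulo \<open>M\<close> and flips the sign of the
  sum.\<close>

lemma real_character_sum_period:
  assumes \<phi>: "real_character M \<phi>" and r: "\<phi> r = -1"
  shows "(\<Sum>a\<in>{0..<M}. \<phi> a) = 0"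
proof -
  have M: "M > 0" using real_characterD(1)[OF \<phi>] .
  have cop: "coprime r M" using real_characterD(5)[OF \<phi>, of r] r by auto
  have inj: "inj_on (\<lambda>a. (r * a) mod M) {0..<M}"
  proof (rule inj_onI)
    fix x y assume xy: "x \<in> {0..<M}" "y \<in> {0..<M}" and "(r * x) mod M = (r * y) mod M"
    hence "[r * x = r * y] (mod M)" by (simp add: cong_def)
    hence "[x = y] (mod M)" using cop by (simp add: cong_mult_lcancel)
    thus "x = y" using xy by (simp add: cong_def)
  qed
  have "(\<lambda>a. (r * a) mod M) ` {0..<M} = {0..<M}"
    using M by (intro endo_inj_surj inj) auto
  hence "bij_betw (\<lambda>a. (r * a) mod M) {0..<M} {0..<M}" using inj by (simp add: bij_betw_def)
  hence "(\<Sum>a\<in>{0..<M}. \<phi> a) = (\<Sum>a\<in>{0..<M}. \<phi> ((r * a) mod M))"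
    by (rule sum.reindex_bij_betw[symmetric])
  also have "\<dots> = (\<Sum>a\<in>{0..<M}. - \<phi> a)"
    by (intro sum.cong refl) (simp add: real_characterD[OF \<phi>] r)
  finally show ?thesis by (simp add: sum_negf)
qed

lemma real_character_block:
  assumes \<phi>: "real_character M \<phi>" and r: "\<phi> r = -1"
  shows "(\<Sum>n\<in>{s..<s + nat M}. \<phi> (int n)) = 0"
proof (induction s)
  case 0
  have M: "M > 0" using real_characterD(1)[OF \<phi>] .
  have "(\<Sum>n\<in>{0..<nat M}. \<phi> (int n)) = (\<Sum>a\<in>int ` {0..<nat M}. \<phi> a)"
    by (subst sum.reindex) simp_all
  also have "int ` {0..<nat M} = {0..<M}" using M image_int_atLeastLessThan[of 0 "nat M"] by simp
  finally show ?case using real_character_sum_period[OF \<phi> r] by simp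
next
  case (Suc s)
  have M: "M > 0" using real_characterD(1)[OF \<phi>] .
  have "\<phi> (int (s + nat M)) = \<phi> (int s)"
    using M by (intro real_character_cong[OF \<phi>]) (simp add: cong_def)
  moreover have "(\<Sum>n\<in>{s..<Suc (s + nat M)}. \<phi> (int n)) =
      (\<Sum>n\<in>{s..<s + nat M}. \<phi> (int n)) + \<phi> (int (s + nat M))" by simp
  moreover have "(\<Sum>n\<in>{s..<Suc (s + nat M)}. \<phi> (int n)) =
      \<phi> (int s) + (\<Sum>n\<in>{Suc s..<Suc (s + nat M)}. \<phi> (int n))"
    using M by (intro sum.atLeast_Suc_lessThan) simp
  ultimately show ?case using Suc.IH by simp
qed

lemma real_character_partial_sum:
  assumes \<phi>: "real_character M \<phi>" and r: "\<phi> r = -1"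
  shows "\<bar>\<Sum>n\<in>{s..<t}. \<phi> (int n)\<bar> \<le> M"
proof (induction "t - s" arbitrary: s rule: less_induct)
  case less
  have M: "M > 0" using real_characterD(1)[OF \<phi>] .
  show ?case
  proof (cases "t - s < nat M")
    case True
    have "\<bar>\<Sum>n\<in>{s..<t}. \<phi> (int n)\<bar> \<le> (\<Sum>n\<in>{s..<t}. \<bar>\<phi> (int n)\<bar>)" by (rule sum_abs)
    also have "\<dots> \<le> (\<Sum>n\<in>{s..<t}. 1)"
      using real_character_abs_le[OF \<phi>] by (intro sum_mono)
    also have "\<dots> \<le> M" using True by simp
    finally show ?thesis .
  next
    case False
    moreover have "nat M > 0" using M by simp
    ultimately have le: "s + nat M \<le> t" by linarith
    have "(\<Sum>n\<in>{s..<t}. \<phi> (int n)) =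
        (\<Sum>n\<in>{s..<s + nat M}. \<phi> (int n)) + (\<Sum>n\<in>{s + nat M..<t}. \<phi> (int n))"
      using le by (subst sum.atLeastLessThan_concat) auto
    also have "\<dots> = (\<Sum>n\<in>{s + nat M..<t}. \<phi> (int n))"
      using real_character_block[OF \<phi> r] by simp
    finally show ?thesis using less[of "s + nat M"] le M by auto
  qed
qed

section \<open>Abel summation and the hyperbola method\<close>

lemma abel_bound:
  fixes v w :: "nat \<Rightarrow> real"
  assumes "\<And>n. n \<ge> s \<Longrightarrow> w n \<ge> 0" "\<And>n. n \<ge> s \<Longrightarrow> w (Suc n) \<le> w n"
    and "\<And>t. \<bar>\<Sum>n\<in>{s..<t}. v n\<bar> \<le> C"
  shows "\<bar>\<Sum>n\<in>{s..<t}. v n * w n\<bar> \<le> C * w s"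
proof -
  have C: "C \<ge> 0" using assms(3)[of s] by simp
  define S where "S t = (\<Sum>n\<in>{s..<t}. v n)" for t
  \<comment> \<open>Summation by parts: the decrements of the weight are nonnegative and telescope,
    so only its first value enters the bound.\<close>
  have eq: "(\<Sum>n\<in>{s..<s + k}. v n * w n) =
      S (s + k) * w (s + k) + (\<Sum>n\<in>{s..<s + k}. S (Suc n) * (w n - w (Suc n)))" for k
    by (induction k) (simp_all add: S_def algebra_simps)
  show ?thesis
  proof (cases "t \<le> s")
    case True
    thus ?thesis using C assms(1)[of s] by simp
  next
    case False
    then obtain k where t: "t = s + k" using le_Suc_ex by (metis linorder_le_cases)
    have "\<bar>\<Sum>n\<in>{s..<t}. v n * w n\<bar> \<le>
        \<bar>S t * w t\<bar> + (\<Sum>n\<in>{s..<t}. \<bar>S (Suc n) * (w n - w (Suc n))\<bar>)"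
      unfolding t eq by (rule order_trans[OF abs_triangle_ineq]) (simp add: sum_abs)
    also have "\<dots> \<le> C * w t + (\<Sum>n\<in>{s..<t}. C * (w n - w (Suc n)))"
    proof (intro add_mono sum_mono)
      show "\<bar>S t * w t\<bar> \<le> C * w t"
        using assms(1)[of t] assms(3)[of t] t by (simp add: S_def abs_mult mult_right_mono)
      fix n assume "n \<in> {s..<t}"
      thus "\<bar>S (Suc n) * (w n - w (Suc n))\<bar> \<le> C * (w n - w (Suc n))"
        using assms(2)[of n] assms(3)[of "Suc n"] by (simp only: S_def abs_mult) (simp add: mult_right_mono)
    qed
    also have "(\<Sum>n\<in>{s..<t}. C * (w n - w (Suc n))) = C * (w s - w t)"
      unfolding t by (induction k) (simp_all add: algebra_simps)
    finally show ?thesis by (simp add: algebra_simps)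
  qed
qed

lemma real_character_weighted_sum:
  assumes \<phi>: "real_character M \<phi>" and r: "\<phi> r = -1" and s: "s > 0"
  shows "\<bar>\<Sum>n\<in>{s..<t}. real_of_int (\<phi> (int n)) / sqrt n\<bar> \<le> M / sqrt s"
proof -
  have "\<bar>\<Sum>n\<in>{s..<t}. real_of_int (\<phi> (int n)) * (1 / sqrt n)\<bar> \<le> M * (1 / sqrt s)"
  proof (rule abel_bound)
    fix t
    have "\<bar>\<Sum>n\<in>{s..<t}. real_of_int (\<phi> (int n))\<bar> = real_of_int \<bar>\<Sum>n\<in>{s..<t}. \<phi> (int n)\<bar>" by simp
    also have "\<dots> \<le> M" using real_character_partial_sum[OF \<phi> r] by (simp only: of_int_le_iff)
    finally show "\<bar>\<Sum>n\<in>{s..<t}. real_of_int (\<phi> (int n))\<bar> \<le> M" .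
  qed (use s in \<open>auto simp: frac_le\<close>)
  thus ?thesis by simp
qed

lemma sum_inverse_sqrt_le: "(\<Sum>n\<in>{1..<Suc Y}. 1 / sqrt n) \<le> 2 * sqrt Y"
proof (induction Y)
  case (Suc Y)
  have "1 / sqrt (Suc Y) \<le> 2 * (sqrt (Suc Y) - sqrt Y)"
  proof -
    have "sqrt (Suc Y) * sqrt Y \<le> (Suc Y + Y) / 2"
      using arith_geo_mean_sqrt[of "Suc Y" Y] by (simp add: real_sqrt_mult)
    hence "1 \<le> 2 * (sqrt (Suc Y) - sqrt Y) * sqrt (Suc Y)" by (simp add: algebra_simps)
    thus ?thesis by (simp add: divide_le_eq)
  qed
  thus ?case using Suc by (simp add: algebra_simps)
qed simp

text \<open>For fixed \<open>a\<close>, the inner sum beyond \<open>b \<le> Y\<close> is a tail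
  starting at \<open>Suc Y\<close>, of size at most \<open>M / sqrt (Suc Y)\<close>, while the
  weights \<open>1 / sqrt a\<close> add up to at most \<open>2 * sqrt Y\<close>. The exponent 1/2 is
  the smallest for which this error stays bounded and the largest for which the squares contribute a
  divergent series.\<close>

lemma hyperbola_half:
  assumes u: "real_character M u" and v: "real_character M v" "v r = -1"
  shows "\<bar>(\<Sum>(a,b)\<in>Sigma {1..<Suc Y} (\<lambda>a. {1..<Suc (Y * Y div a)}).
              (real_of_int (u (int a)) / sqrt a) * (real_of_int (v (int b)) / sqrt b)) -
            (\<Sum>a\<in>{1..<Suc Y}. real_of_int (u (int a)) / sqrt a) *
            (\<Sum>b\<in>{1..<Suc Y}. real_of_int (v (int b)) / sqrt b)\<bar> \<le> 2 * M"
proof -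
  define U V where "U a = real_of_int (u (int a)) / sqrt a" and "V b = real_of_int (v (int b)) / sqrt b"
    for a b :: nat
  have M: "M > 0" using real_characterD(1)[OF u] .
  have split: "(\<Sum>b\<in>{1..<Suc (Y * Y div a)}. V b) =
      (\<Sum>b\<in>{1..<Suc Y}. V b) + (\<Sum>b\<in>{Suc Y..<Suc (Y * Y div a)}. V b)" if "a \<in> {1..<Suc Y}" for a
  proof -
    have "Y \<le> Y * Y div a" using that by (simp add: less_eq_div_iff_mult_less_eq)
    thus ?thesis by (subst sum.atLeastLessThan_concat) auto
  qed
  have "(\<Sum>(a,b)\<in>Sigma {1..<Suc Y} (\<lambda>a. {1..<Suc (Y * Y div a)}). U a * V b) =
      (\<Sum>a\<in>{1..<Suc Y}. U a * (\<Sum>b\<in>{1..<Suc (Y * Y div a)}. V b))"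
    by (subst sum.Sigma[symmetric]) (simp_all add: sum_distrib_left del: sum.op_ivl_Suc)
  also have "\<dots> = (\<Sum>a\<in>{1..<Suc Y}. U a * (\<Sum>b\<in>{1..<Suc Y}. V b) +
      U a * (\<Sum>b\<in>{Suc Y..<Suc (Y * Y div a)}. V b))"
    by (intro sum.cong refl) (simp only: split distrib_left)
  also have "\<dots> = (\<Sum>a\<in>{1..<Suc Y}. U a) * (\<Sum>b\<in>{1..<Suc Y}. V b) +
      (\<Sum>a\<in>{1..<Suc Y}. U a * (\<Sum>b\<in>{Suc Y..<Suc (Y * Y div a)}. V b))"
    by (simp only: sum.distrib sum_distrib_right)
  finally have eq: "(\<Sum>(a,b)\<in>Sigma {1..<Suc Y} (\<lambda>a. {1..<Suc (Y * Y div a)}). U a * V b) -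
      (\<Sum>a\<in>{1..<Suc Y}. U a) * (\<Sum>b\<in>{1..<Suc Y}. V b) =
      (\<Sum>a\<in>{1..<Suc Y}. U a * (\<Sum>b\<in>{Suc Y..<Suc (Y * Y div a)}. V b))" by simp
  have "\<bar>\<Sum>a\<in>{1..<Suc Y}. U a * (\<Sum>b\<in>{Suc Y..<Suc (Y * Y div a)}. V b)\<bar> \<le>
      (\<Sum>a\<in>{1..<Suc Y}. 1 / sqrt a * (M / sqrt (Suc Y)))"
  proof (rule order_trans[OF sum_abs], rule sum_mono)
    fix a assume a: "a \<in> {1..<Suc Y}"
    have "\<bar>U a\<bar> \<le> 1 / sqrt a"
      using real_character_abs_le[OF u, of "int a"] by (simp add: U_def divide_right_mono del: of_int_abs flip: of_int_abs)
    moreover have "\<bar>\<Sum>b\<in>{Suc Y..<Suc (Y * Y div a)}. V b\<bar> \<le> M / sqrt (Suc Y)"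
      unfolding V_def by (rule real_character_weighted_sum[OF v]) simp
    ultimately show "\<bar>U a * (\<Sum>b\<in>{Suc Y..<Suc (Y * Y div a)}. V b)\<bar> \<le> 1 / sqrt a * (M / sqrt (Suc Y))"
      unfolding abs_mult by (intro mult_mono) auto
  qed
  also have "\<dots> = (\<Sum>a\<in>{1..<Suc Y}. 1 / sqrt a) * (M / sqrt (Suc Y))"
    by (simp only: sum_distrib_right)
  also have "\<dots> \<le> 2 * sqrt Y * (M / sqrt (Suc Y))"
    using M by (intro mult_right_mono sum_inverse_sqrt_le) simp
  also have "\<dots> \<le> 2 * sqrt (Suc Y) * (M / sqrt (Suc Y))"
    using M by (intro mult_right_mono) simp_all
  also have "\<dots> = 2 * M" by simp
  finally show ?thesis using eq unfolding U_def V_def by simp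
qed

text \<open>The region is the union of the two halves treated in \<open>hyperbola_half\<close>,
  which overlap in a square. Each half differs from the product over the square by at most
  \<open>2 * M\<close>, and that product is at most \<open>M * M\<close> because neither character
  is principal.\<close>

lemma hyperbola_bound:
  assumes u: "real_character M u" "u r = -1" and v: "real_character M v" "v r' = -1"
  shows "\<bar>\<Sum>(a,b) | a > 0 \<and> b > 0 \<and> a * b \<le> Y * Y.
           (real_of_int (u (int a)) / sqrt a) * (real_of_int (v (int b)) / sqrt b)\<bar> \<le> 4 * M + M * M"
proof -
  define U V where "U a = real_of_int (u (int a)) / sqrt a" and "V b = real_of_int (v (int b)) / sqrt b"
    for a b :: nat
  define R where "R = {(a::nat, b::nat). a > 0 \<and> b > 0 \<and> a * b \<le> Y * Y}"
  define R1 where "R1 = Sigma {1..<Suc Y} (\<lambda>a. {1..<Suc (Y * Y div a)})"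
  define R2 where "R2 = prod.swap ` R1"
  have M: "M > 0" using real_characterD(1)[OF u(1)] .
  have mem1: "(a, b) \<in> R1 \<longleftrightarrow> a > 0 \<and> b > 0 \<and> a \<le> Y \<and> a * b \<le> Y * Y" for a b
    by (cases "a = 0") (auto simp: R1_def less_Suc_eq_le less_eq_div_iff_mult_less_eq mult.commute)
  have mem2: "(a, b) \<in> R2 \<longleftrightarrow> a > 0 \<and> b > 0 \<and> b \<le> Y \<and> a * b \<le> Y * Y" for a b
    using mem1[of b a] by (force simp: R2_def mult.commute image_iff)
  have fin: "finite R1" "finite R2" by (simp_all add: R1_def R2_def)
  have le: "a \<le> Y \<or> b \<le> Y" if "a * b \<le> Y * Y" for a b
  proof (rule ccontr)
    assume "\<not> ?thesis"
    hence "Suc Y * Suc Y \<le> a * b" by (intro mult_le_mono) auto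
    thus False using that by simp
  qed
  have un: "R1 \<union> R2 = R" by (auto simp: R_def mem1 mem2 dest: le)
  have "R1 \<inter> R2 = {1..<Suc Y} \<times> {1..<Suc Y}"
    by (auto simp: mem1 mem2 mult_le_mono)
  hence int: "sum g (R1 \<inter> R2) = (\<Sum>a\<in>{1..<Suc Y}. \<Sum>b\<in>{1..<Suc Y}. g (a, b))" for g :: "nat \<times> nat \<Rightarrow> real"
    by (simp add: sum.cartesian_product del: sum.op_ivl_Suc)
  have "(\<Sum>(a,b)\<in>R. U a * V b) + (\<Sum>(a,b)\<in>R1 \<inter> R2. U a * V b) =
      (\<Sum>(a,b)\<in>R1. U a * V b) + (\<Sum>(a,b)\<in>R2. U a * V b)"
    using sum.union_inter[OF fin] un by metis
  moreover have "(\<Sum>(a,b)\<in>R1 \<inter> R2. U a * V b) = (\<Sum>a\<in>{1..<Suc Y}. U a) * (\<Sum>b\<in>{1..<Suc Y}. V b)"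
    unfolding int by (simp add: sum_product del: sum.op_ivl_Suc)
  moreover have "(\<Sum>(a,b)\<in>R2. U a * V b) = (\<Sum>(b,a)\<in>R1. V b * U a)"
    unfolding R2_def by (subst sum.reindex) (auto simp: case_prod_unfold mult.commute intro!: sum.cong)
  moreover have "\<bar>(\<Sum>(a,b)\<in>R1. U a * V b) - (\<Sum>a\<in>{1..<Suc Y}. U a) * (\<Sum>b\<in>{1..<Suc Y}. V b)\<bar> \<le> 2 * M"
    unfolding U_def V_def R1_def by (rule hyperbola_half[OF u(1) v])
  moreover have "\<bar>(\<Sum>(b,a)\<in>R1. V b * U a) - (\<Sum>b\<in>{1..<Suc Y}. V b) * (\<Sum>a\<in>{1..<Suc Y}. U a)\<bar> \<le> 2 * M"
    unfolding U_def V_def R1_def by (rule hyperbola_half[OF v(1) u])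
  hence "\<bar>(\<Sum>(b,a)\<in>R1. V b * U a) - (\<Sum>a\<in>{1..<Suc Y}. U a) * (\<Sum>b\<in>{1..<Suc Y}. V b)\<bar> \<le> 2 * M"
    by (simp only: mult.commute[of "sum V _" "sum U _"])
  moreover have "\<bar>(\<Sum>a\<in>{1..<Suc Y}. U a) * (\<Sum>b\<in>{1..<Suc Y}. V b)\<bar> \<le> M * M"
  proof -
    have "\<bar>\<Sum>a\<in>{1..<Suc Y}. U a\<bar> \<le> M" "\<bar>\<Sum>b\<in>{1..<Suc Y}. V b\<bar> \<le> M"
      using real_character_weighted_sum[OF u, of 1 "Suc Y"] real_character_weighted_sum[OF v, of 1 "Suc Y"]
      by (simp_all add: U_def V_def)
    thus ?thesis unfolding abs_mult of_int_mult using M by (intro mult_mono) auto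
  qed
  ultimately have "\<bar>\<Sum>(a,b)\<in>R. U a * V b\<bar> \<le> 4 * real_of_int M + real_of_int (M * M)"
    unfolding of_int_mult of_int_numeral by linarith
  thus ?thesis unfolding U_def V_def R_def by simp
qed

section \<open>Divisor sums of a real character\<close>

definition divisor_sum :: "(int \<Rightarrow> int) \<Rightarrow> nat \<Rightarrow> int" where
  "divisor_sum \<phi> n = (\<Sum>d | d dvd n. \<phi> (int d))"

lemma divisor_sum_prime_power_mult:
  assumes \<phi>: "real_character M \<phi>" and p: "prime p" and m: "\<not> p dvd m" "m > 0"
  shows "divisor_sum \<phi> (p ^ k * m) = (\<Sum>i\<le>k. \<phi> (int p) ^ i) * divisor_sum \<phi> m"
proof -
  have p0: "p > 0" using p prime_gt_0_nat by blast
  have "bij_betw (\<lambda>(i, e). p ^ i * e) ({..k} \<times> {e. e dvd m}) {d. d dvd p ^ k * m}"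
  proof (rule bij_betw_imageI)
    show "inj_on (\<lambda>(i, e). p ^ i * e) ({..k} \<times> {e. e dvd m})"
    proof (rule inj_onI, clarsimp)
      fix i e i' e'
      assume e: "e dvd m" "e' dvd m" and eq: "p ^ i * e = p ^ i' * e'"
      have "multiplicity p (p ^ i * e) = i" "multiplicity p (p ^ i' * e') = i'"
        using e m p by (auto intro!: multiplicity_prime_elem_times_other simp: not_dvd_imp_multiplicity_0
            prime_elem_multiplicity_mult_distrib multiplicity_same_power dvd_pos_nat)
          (metis dvd_trans not_dvd_imp_multiplicity_0 multiplicity_prime_elem_times_other)+
      hence "i = i'" using eq by simp
      thus "i = i' \<and> e = e'" using eq p0 by simp
    qed
    show "(\<lambda>(i, e). p ^ i * e) ` ({..k} \<times> {e. e dvd m}) = {d. d dvd p ^ k * m}"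
    proof (intro equalityI subsetI)
      fix d assume "d \<in> {d. d dvd p ^ k * m}"
      then obtain b c where bc: "d = b * c" "b dvd p ^ k" "c dvd m"
        using division_decomp[of d "p ^ k" m] by blast
      then obtain i where "i \<le> k" "b = p ^ i" using divides_primepow_nat[OF p] by blast
      thus "d \<in> (\<lambda>(i, e). p ^ i * e) ` ({..k} \<times> {e. e dvd m})" using bc by force
    qed (auto simp: le_imp_power_dvd mult_dvd_mono)
  qed
  hence "divisor_sum \<phi> (p ^ k * m) = (\<Sum>(i, e)\<in>{..k} \<times> {e. e dvd m}. \<phi> (int (p ^ i * e)))"
    unfolding divisor_sum_def by (subst sum.reindex_bij_betw[symmetric]) (auto simp: case_prod_unfold)
  also have "\<dots> = (\<Sum>(i, e)\<in>{..k} \<times> {e. e dvd m}. \<phi> (int p) ^ i * \<phi> (int e))"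
    by (simp add: real_characterD(2)[OF \<phi>] real_character_power[OF \<phi>])
  also have "\<dots> = (\<Sum>i\<le>k. \<phi> (int p) ^ i) * divisor_sum \<phi> m"
    unfolding divisor_sum_def by (simp add: sum_product sum.cartesian_product)
  finally show ?thesis .
qed

text \<open>The divisor sum is a product over primes: the factor at \<open>p ^ k\<close> is
  \<open>k + 1\<close> if \<open>\<phi> p = 1\<close>, and 1 or 0 according to the parity of
  \<open>k\<close> if \<open>\<phi> p = -1\<close>. A nonzero value thus forces
  \<open>\<psi> p ^ k = 1\<close> in both cases. Squares enter through even multiplicities, a
  condition that passes to the cofactor \<open>m\<close> in the induction.\<close>

lemma divisor_sum_properties:
  assumes \<phi>: "real_character M \<phi>" and \<psi>: "real_character M \<psi>"
    and imp: "\<And>p. prime p \<Longrightarrow> \<phi> (int p) = 1 \<Longrightarrow> \<psi> (int p) = 1"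
    and n: "n > 0" "coprime (int n) M"
  shows "divisor_sum \<phi> n \<ge> 0 \<and> (divisor_sum \<phi> n \<noteq> 0 \<longrightarrow> \<psi> (int n) = 1) \<and>
           ((\<forall>p. prime p \<longrightarrow> even (multiplicity p n)) \<longrightarrow> divisor_sum \<phi> n \<ge> 1)"
  using n
proof (induction n rule: less_induct)
  case (less n)
  show ?case
  proof (cases "n = 1")
    case True
    thus ?thesis by (simp add: divisor_sum_def real_character_1[OF \<phi>] real_character_1[OF \<psi>])
  next
    case False
    then obtain p where p: "prime p" "p dvd n" using prime_factor_nat by blast
    define k where "k = multiplicity p n"
    have "\<not> is_unit p" using p(1) not_prime_unit by blast
    then obtain m where m: "n = p ^ k * m" "\<not> p dvd m"
      using multiplicity_decompose'[of n p] less.prems unfolding k_def by auto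
    have k: "k > 0" unfolding k_def using p less.prems by (simp add: prime_multiplicity_gt_zero_iff)
    have m0: "m > 0" using m(1) less.prems(1) by (cases "m = 0") auto
    have "p ^ k > 1" using k p(1) by (intro one_less_power prime_gt_1_nat)
    hence mn: "m < n" using m m0 by simp
    have cop: "coprime (int p) M" "coprime (int m) M"
      using less.prems(2) m(1) k by (auto simp: coprime_power_left_iff)
    have IH: "divisor_sum \<phi> m \<ge> 0" "divisor_sum \<phi> m \<noteq> 0 \<Longrightarrow> \<psi> (int m) = 1"
      "\<forall>q. prime q \<longrightarrow> even (multiplicity q m) \<Longrightarrow> divisor_sum \<phi> m \<ge> 1"
      using less.IH[OF mn m0 cop(2)] by blast+
    have ev: "even (multiplicity q m)" if ev: "\<forall>q. prime q \<longrightarrow> even (multiplicity q n)" and q: "prime q" for q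
    proof (cases "q = p")
      case False
      have "multiplicity q n = multiplicity q (p ^ k) + multiplicity q m"
        unfolding m(1) using q p m0 by (intro prime_elem_multiplicity_mult_distrib) auto
      moreover have "multiplicity q (p ^ k) = 0"
        using False q p(1) by (simp add: prime_multiplicity_other multiplicity_distinct_prime_power)
      ultimately show ?thesis using ev[rule_format, OF q] by simp
    qed (use m(2) in \<open>simp add: not_dvd_imp_multiplicity_0\<close>)
    have eq: "divisor_sum \<phi> n = (\<Sum>i\<le>k. \<phi> (int p) ^ i) * divisor_sum \<phi> m"
      unfolding m(1) by (rule divisor_sum_prime_power_mult[OF \<phi> p(1) m(2) m0])
    have \<psi>n: "\<psi> (int n) = \<psi> (int p) ^ k * \<psi> (int m)"
      unfolding m(1) by (simp add: real_characterD(2)[OF \<psi>] real_character_power[OF \<psi>])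
    have "\<phi> (int p) \<noteq> 0" "\<psi> (int p) \<noteq> 0"
      using cop(1) real_characterD(5)[OF \<phi>] real_characterD(5)[OF \<psi>] by blast+
    then consider "\<phi> (int p) = 1" | "\<phi> (int p) = -1" "\<psi> (int p) = 1 \<or> \<psi> (int p) = -1"
      using real_characterD(4)[OF \<phi>, of "int p"] real_characterD(4)[OF \<psi>, of "int p"] by auto
    thus ?thesis
    proof cases
      case 1
      hence "\<psi> (int p) = 1" using imp p by blast
      moreover have "(\<Sum>i\<le>k. \<phi> (int p) ^ i) = int k + 1" using 1 by simp
      moreover have "(int k + 1) * divisor_sum \<phi> m \<ge> 0" using IH(1) by simp
      moreover have "(int k + 1) * divisor_sum \<phi> m \<ge> 1" if "divisor_sum \<phi> m \<ge> 1"
        using that mult_mono[of 1 "int k + 1" 1 "divisor_sum \<phi> m"] by simp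
      ultimately show ?thesis using eq \<psi>n IH ev by auto
    next
      case 2
      have "(\<Sum>i\<le>k. \<phi> (int p) ^ i) = (if even k then 1 else 0)"
        using 2 by (induction k) auto
      moreover have "\<psi> (int p) ^ k = 1" if "even k" using 2(2) that by auto
      moreover have "even k" if "\<forall>q. prime q \<longrightarrow> even (multiplicity q n)" using that p k_def by blast
      ultimately show ?thesis using eq \<psi>n IH ev by auto
    qed
  qed
qed

text \<open>For \<open>j \<ge> 1\<close> the numbers \<open>1 + j * M\<close> are coprime to
  \<open>M\<close> and at most \<open>(M + 1) * j\<close>, which compares the sum with the full
  harmonic series.\<close>

lemma harmonic_progression_unbounded:
  fixes M :: nat
  assumes "M > 0"
  shows "\<exists>Y. C < (\<Sum>k | 0 < k \<and> k \<le> Y \<and> coprime k M. 1 / real k)"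
proof -
  have "\<exists>J. C * (M + 1) < (\<Sum>j<J. inverse (real j))"
  proof (rule ccontr)
    assume "\<not> ?thesis"
    hence "summable (\<lambda>j. inverse (real j))"
      by (intro bounded_imp_summable[where B = "C * (M + 1)"]) (auto simp: not_less lessThan_Suc_atMost[symmetric] simp del: sum.lessThan_Suc)
    thus False using not_summable_harmonic by blast
  qed
  then obtain J where J: "C * (M + 1) < (\<Sum>j<J. inverse (real j))" by blast
  define f where "f j = 1 + j * M" for j :: nat
  have "(\<Sum>j<J. inverse (real j)) = (\<Sum>j\<in>{1..<J}. inverse (real j))"
    by (intro sum.mono_neutral_right) (auto simp: Suc_le_eq)
  also have "\<dots> \<le> (\<Sum>j\<in>{1..<J}. (M + 1) * (1 / f j))"
  proof (rule sum_mono)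
    fix j assume j: "j \<in> {1..<J}"
    hence "f j \<le> (M + 1) * j" by (simp add: f_def algebra_simps)
    hence "real (f j) \<le> (M + 1) * j" by (metis of_nat_le_iff of_nat_mult)
    moreover have f0: "f j > 0" by (simp add: f_def)
    ultimately show "inverse (real j) \<le> (M + 1) * (1 / f j)" using j f0 by (simp add: divide_simps algebra_simps)
  qed
  also have "\<dots> = (M + 1) * (\<Sum>j\<in>{1..<J}. 1 / f j)" by (simp add: sum_distrib_left)
  also have "(\<Sum>j\<in>{1..<J}. 1 / f j) = (\<Sum>k\<in>f ` {1..<J}. 1 / real k)"
    using assms by (subst sum.reindex) (auto simp: inj_on_def f_def)
  also have "\<dots> \<le> (\<Sum>k | 0 < k \<and> k \<le> f J \<and> coprime k M. 1 / real k)"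
  proof (rule sum_mono2)
    show "f ` {1..<J} \<subseteq> {k. 0 < k \<and> k \<le> f J \<and> coprime k M}"
    proof
      fix k assume "k \<in> f ` {1..<J}"
      then obtain j where j: "j < J" "k = 1 + j * M" by (auto simp: f_def)
      have "coprime k M" unfolding j(2)
        by (metis coprime_1_left coprime_iff_gcd_eq_1 gcd_add_mult gcd.commute add.commute)
      thus "k \<in> {k. 0 < k \<and> k \<le> f J \<and> coprime k M}" using j by (simp add: f_def)
    qed
  qed auto
  finally have "(\<Sum>j<J. inverse (real j)) \<le> (M + 1) * (\<Sum>k | 0 < k \<and> k \<le> f J \<and> coprime k M. 1 / real k)"
    by (simp add: mult_left_mono)
  with J have "C * (M + 1) < (M + 1) * (\<Sum>k | 0 < k \<and> k \<le> f J \<and> coprime k M. 1 / real k)"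
    by (rule less_le_trans)
  hence "real (M + 1) * C < (M + 1) * (\<Sum>k | 0 < k \<and> k \<le> f J \<and> coprime k M. 1 / real k)"
    by (simp only: mult.commute)
  hence "C < (\<Sum>k | 0 < k \<and> k \<le> f J \<and> coprime k M. 1 / real k)"
    by (rule mult_left_less_imp_less) simp
  thus ?thesis by blast
qed

text \<open>If \<open>\<psi>\<close> were trivial on all primes split by \<open>\<phi>\<close>, then \<open>\<Sum>d | n. \<phi> d\<close>, twisted by \<open>\<psi>\<close>, would be
  nonnegative and at least 1 at the squares, so that its sum with weights \<open>1 / sqrt n\<close> would
  diverge; the hyperbola method bounds the same sum.\<close>

theorem exists_prime_with_character_values:
  assumes \<phi>: "real_character M \<phi>" and \<psi>: "real_character M \<psi>"
    and r: "\<psi> r = -1" and r': "\<phi> r' * \<psi> r' = -1"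
  shows "\<exists>p. prime p \<and> \<phi> (int p) = 1 \<and> \<psi> (int p) = -1"
proof (rule ccontr)
  assume neg: "\<not> ?thesis"
  have M: "M > 0" using real_characterD(1)[OF \<phi>] .
  have imp: "\<psi> (int p) = 1" if "prime p" "\<phi> (int p) = 1" for p
  proof -
    have "\<psi> (int p) \<noteq> -1" using neg that by blast
    \<comment> \<open>Both characters have modulus \<open>M\<close> and therefore vanish at the same
      integers.\<close>
    moreover have "\<psi> (int p) \<noteq> 0"
      using that(2) real_characterD(5)[OF \<phi>, of "int p"] real_characterD(5)[OF \<psi>, of "int p"] by auto
    ultimately show ?thesis using real_characterD(4)[OF \<psi>, of "int p"] by auto
  qed
  define g where "g n = real_of_int (\<psi> (int n) * divisor_sum \<phi> n) / sqrt n" for n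
  have g0: "g n \<ge> 0" if "n > 0" for n
  proof (cases "coprime (int n) M")
    case True
    show ?thesis using divisor_sum_properties[OF \<phi> \<psi> imp that True]
      by (cases "divisor_sum \<phi> n = 0") (auto simp: g_def)
  next
    case False
    hence "\<psi> (int n) = 0" using real_characterD(5)[OF \<psi>] by blast
    thus ?thesis by (simp add: g_def)
  qed
  have gsq: "g (k * k) \<ge> 1 / k" if k: "k > 0" "coprime k (nat M)" for k
  proof -
    have "coprime (int k) M" using k(2) M by (metis coprime_int_iff int_nat_eq less_imp_le)
    hence "coprime (int (k * k)) M" by simp
    moreover have "even (multiplicity p (k * k))" if "prime p" for p
      using that k by (subst prime_elem_multiplicity_mult_distrib) auto
    ultimately have ds: "divisor_sum \<phi> (k * k) \<ge> 1" "\<psi> (int (k * k)) = 1"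
      using divisor_sum_properties[OF \<phi> \<psi> imp, of "k * k"] k(1) by force+
    hence "1 \<le> \<psi> (int (k * k)) * divisor_sum \<phi> (k * k)" by simp
    hence "1 \<le> real_of_int (\<psi> (int (k * k)) * divisor_sum \<phi> (k * k))" by linarith
    thus ?thesis unfolding g_def using k(1) by (simp add: divide_right_mono)
  qed
  obtain Y where Y: "4 * M + M * M < (\<Sum>k | 0 < k \<and> k \<le> Y \<and> coprime k (nat M). 1 / real k)"
    using harmonic_progression_unbounded[of "nat M" "4 * M + M * M"] M by auto
  define S where "S = {k. 0 < k \<and> k \<le> Y \<and> coprime k (nat M)}"
  have "(\<Sum>k\<in>S. 1 / real k) \<le> (\<Sum>k\<in>S. g (k * k))"
    by (intro sum_mono) (auto simp: S_def gsq)
  also have "\<dots> = sum g ((\<lambda>k. k * k) ` S)"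
    by (subst sum.reindex) (auto simp: inj_on_def power2_eq_square[symmetric])
  also have "\<dots> \<le> sum g {1..Y * Y}"
    by (intro sum_mono2) (auto simp: S_def g0 Suc_le_eq mult_le_mono)
  \<comment> \<open>With \<open>n = a * b\<close> one has
    \<open>\<psi> n * \<phi> b = \<psi> a * (\<phi> b * \<psi> b)\<close>: the twisted divisor sum
    is the convolution of \<psi> with the product character, and \<open>r\<close>, \<open>r'\<close>
    show that neither of these is principal.\<close>
  also have "\<dots> = (\<Sum>(n, b)\<in>Sigma {1..Y * Y} (\<lambda>n. {d. d dvd n}).
      (real_of_int (\<psi> (int (n div b))) / sqrt (n div b)) * (real_of_int (\<phi> (int b) * \<psi> (int b)) / sqrt b))"
  proof (subst sum.Sigma[symmetric], simp, force, rule sum.cong[OF refl])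
    fix n assume n: "n \<in> {1..Y * Y}"
    show "g n = (\<Sum>b | b dvd n. (real_of_int (\<psi> (int (n div b))) / sqrt (n div b)) *
        (real_of_int (\<phi> (int b) * \<psi> (int b)) / sqrt b))"
      unfolding g_def divisor_sum_def of_int_mult of_int_sum sum_distrib_left sum_divide_distrib
    proof (rule sum.cong[OF refl])
      fix b assume "b \<in> {d. d dvd n}"
      then obtain a where a: "n = b * a" by auto
      hence ab: "a > 0" "b > 0" using n by (auto intro: Nat.gr0I)
      thus "real_of_int (\<psi> (int n)) * real_of_int (\<phi> (int b)) / sqrt n =
          real_of_int (\<psi> (int (n div b))) / sqrt (n div b) *
          (real_of_int (\<phi> (int b)) * real_of_int (\<psi> (int b)) / sqrt b)"
        by (simp add: a real_characterD(2)[OF \<psi>] real_sqrt_mult mult_ac)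
    qed
  qed
  also have "\<dots> = (\<Sum>(a, b) | a > 0 \<and> b > 0 \<and> a * b \<le> Y * Y.
      (real_of_int (\<psi> (int a)) / sqrt a) * (real_of_int (\<phi> (int b) * \<psi> (int b)) / sqrt b))"
  proof (rule sum.reindex_bij_witness[where i = "\<lambda>(a, b). (a * b, b)" and j = "\<lambda>(n, b). (n div b, b)"],
      goal_cases)
    case (1 x) thus ?case by auto
  next
    case (2 x) thus ?case by (auto elim!: dvdE simp: mult.commute)
  next
    case (3 x) thus ?case by auto
  next
    case (4 x) thus ?case by (auto simp: Suc_le_eq)
  next
    case (5 x) thus ?case by auto
  qed
  also have "\<dots> \<le> 4 * M + M * M"
    using hyperbola_bound[OF \<psi> r real_character_mult[OF \<phi> \<psi>] r', of Y] by simp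
  finally show False using Y unfolding S_def by simp
qed

section \<open>The character of a negative discriminant\<close>

lemma Legendre_cong: "[a = b] (mod p) \<Longrightarrow> Legendre a p = Legendre b p"
proof -
  assume ab: "[a = b] (mod p)"
  hence "QuadRes p a \<longleftrightarrow> QuadRes p b"
    unfolding QuadRes_def using cong_trans cong_sym by blast
  moreover have "[a = 0] (mod p) \<longleftrightarrow> [b = 0] (mod p)" using ab cong_trans cong_sym by blast
  ultimately show ?thesis by (simp add: Legendre_def)
qed

lemma Legendre_values: "Legendre a p \<in> {-1, 0, 1}"
  by (simp add: Legendre_def)

lemma Legendre_eq_0_iff: "Legendre a p = 0 \<longleftrightarrow> p dvd a"
  by (simp add: Legendre_def cong_0_iff)

text \<open>The values \<open>-1\<close>, 0 and 1 are distinct modulo \<open>p > 2\<close>, so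
  congruences obtained from Euler's criterion become equalities.\<close>

lemma Legendre_eqI:
  assumes "p > 2" "x \<in> {-1, 0, 1}" "y \<in> {-1, 0, 1}" "[x = y] (mod p)"
  shows "x = (y::int)"
proof -
  have "p dvd x - y" using assms(4) by (simp add: cong_iff_dvd_diff)
  moreover have "\<bar>x - y\<bar> < p" using assms by auto
  ultimately show ?thesis using zdvd_imp_le[of p "\<bar>x - y\<bar>"] by force
qed

lemma Legendre_mult:
  assumes "prime p" "p > 2"
  shows "Legendre (a * b) (int p) = Legendre a (int p) * Legendre b (int p)"
proof (rule Legendre_eqI)
  have 1: "[Legendre (a * b) (int p) = a ^ ((p - 1) div 2) * b ^ ((p - 1) div 2)] (mod int p)"
    using euler_criterion[OF assms, of "a * b"] by (simp only: power_mult_distrib)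
  have 2: "[Legendre a (int p) * Legendre b (int p) = a ^ ((p - 1) div 2) * b ^ ((p - 1) div 2)] (mod int p)"
    using assms by (intro cong_mult euler_criterion)
  show "[Legendre (a * b) (int p) = Legendre a (int p) * Legendre b (int p)] (mod int p)"
    by (rule cong_trans[OF 1 cong_sym[OF 2]])
qed (use assms in \<open>simp_all add: Legendre_def\<close>)

lemma Legendre_minus_1:
  assumes "prime p" "p > 2"
  shows "Legendre (-1) (int p) = (if p mod 4 = 1 then 1 else -1)"
proof (rule Legendre_eqI)
  have "odd p" using assms prime_odd_nat by blast
  hence "p mod 4 = 1 \<or> p mod 4 = 3" by presburger
  hence "(-1::int) ^ ((p - 1) div 2) = (if p mod 4 = 1 then 1 else -1)"
  proof
    assume "p mod 4 = 1"
    then obtain j where "p = 4 * j + 1" by (metis mult_div_mod_eq)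
    thus ?thesis by simp
  next
    assume "p mod 4 = 3"
    then obtain j where "p = 4 * j + 3" by (metis mult_div_mod_eq)
    thus ?thesis by simp
  qed
  thus "[Legendre (-1) (int p) = (if p mod 4 = 1 then 1 else -1)] (mod int p)"
    using euler_criterion[OF assms, of "-1"] by simp
qed (use assms in \<open>simp_all add: Legendre_def\<close>)

definition chi4 :: "int \<Rightarrow> int" where
  "chi4 a = (if a mod 4 = 1 then 1 else if a mod 4 = 3 then -1 else 0)"

definition chi8 :: "int \<Rightarrow> int" where
  "chi8 a = (if a mod 8 \<in> {1, 7} then 1 else if a mod 8 \<in> {3, 5} then -1 else 0)"

lemma chi4_mod [simp]: "chi4 (a mod 4) = chi4 a"
  by (simp add: chi4_def)

lemma chi8_mod [simp]: "chi8 (a mod 8) = chi8 a"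
  by (simp add: chi8_def)

lemma chi4_mult: "chi4 (a * b) = chi4 a * chi4 b"
proof -
  have *: "\<forall>i\<in>{0, 1, 2, 3}. \<forall>j\<in>{0, 1, 2, 3}. chi4 (i * j) = chi4 i * chi4 j"
    by (simp add: chi4_def)
  have range: "c mod 4 \<in> {0, 1, 2, 3}" for c :: int
    using pos_mod_bound[of 4 c] pos_mod_sign[of 4 c] by force
  have "chi4 (a * b) = chi4 ((a mod 4) * (b mod 4))"
    by (metis chi4_mod mod_mult_eq)
  also have "\<dots> = chi4 (a mod 4) * chi4 (b mod 4)" using * range by blast
  finally show ?thesis by simp
qed

lemma chi8_mult: "chi8 (a * b) = chi8 a * chi8 b"
proof -
  have *: "\<forall>i\<in>{0, 1, 2, 3, 4, 5, 6, 7}. \<forall>j\<in>{0, 1, 2, 3, 4, 5, 6, 7}. chi8 (i * j) = chi8 i * chi8 j"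
    by (simp add: chi8_def)
  have range: "c mod 8 \<in> {0, 1, 2, 3, 4, 5, 6, 7}" for c :: int
    using pos_mod_bound[of 8 c] pos_mod_sign[of 8 c] by force
  have "chi8 (a * b) = chi8 ((a mod 8) * (b mod 8))"
    by (metis chi8_mod mod_mult_eq)
  also have "\<dots> = chi8 (a mod 8) * chi8 (b mod 8)" using * range by blast
  finally show ?thesis by simp
qed

lemma odd_mod_4: "odd a \<Longrightarrow> a mod 4 = 1 \<or> a mod 4 = (3 :: int)"
  by presburger

lemma odd_mod_8: "odd a \<Longrightarrow> a mod 8 = 1 \<or> a mod 8 = 3 \<or> a mod 8 = 5 \<or> a mod 8 = (7 :: int)"
  by presburger

lemma chi4_odd: "odd a \<Longrightarrow> chi4 a \<in> {-1, 1}"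
  using odd_mod_4[of a] unfolding chi4_def by force

lemma chi8_odd: "odd a \<Longrightarrow> chi8 a \<in> {-1, 1}"
  using odd_mod_8[of a] unfolding chi8_def by force

text \<open>By Gauss's lemma the sign is determined by how many of \<open>2, 4, ..., 2 * h\<close>
  exceed \<open>h = (p - 1) / 2\<close>. That number is \<open>h - h div 2\<close>, whose parity
  depends on \<open>h\<close> modulo 4, that is, on \<open>p\<close> modulo 8.\<close>

lemma Legendre_2:
  assumes "prime p" "p > 2"
  shows "Legendre 2 (int p) = chi8 (int p)"
proof -
  have np: "\<not> int p dvd 2" using assms(2) zdvd_imp_le[of "int p" 2] by auto
  interpret GAUSS p 2
    using assms np by unfold_locales (auto simp: cong_0_iff)
  have p1: "odd p" using assms prime_odd_nat by blast
  define h where "h = (int p - 1) div 2"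
  have p: "int p = 2 * h + 1" using p1 unfolding h_def by (auto elim!: oddE)
  have h0: "h \<ge> 1" using assms(2) p by linarith
  have C: "C = (\<lambda>x. 2 * x) ` {0<..h}"
  proof -
    have "x * 2 mod int p = 2 * x" if "x \<in> {0<..h}" for x
      using that p by simp
    thus ?thesis unfolding C_def B_def A_def h_def[symmetric] image_image by (intro image_cong) auto
  qed
  have "E = (\<lambda>x. 2 * x) ` {h div 2<..h}"
    unfolding E_def C h_def[symmetric] by auto
  hence "card E = nat (h - h div 2)" by (simp add: card_image inj_on_def)
  hence L: "Legendre 2 (int p) = (-1) ^ nat (h - h div 2)" using gauss_lemma by simp
  define i where "i = h div 4"
  have i: "i \<ge> 0" using h0 by (simp add: i_def)
  have "h = 4 * i \<or> h = 4 * i + 1 \<or> h = 4 * i + 2 \<or> h = 4 * i + 3" unfolding i_def by presburger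
  thus ?thesis
  proof (elim disjE)
    assume h: "h = 4 * i"
    have n: "nat (h - h div 2) = 2 * nat i" and m: "int p = 8 * i + 1" using i h p by auto
    have "int p mod 8 = 1" unfolding m by simp
    thus ?thesis using L n by (simp add: chi8_def)
  next
    assume h: "h = 4 * i + 1"
    have n: "nat (h - h div 2) = 2 * nat i + 1" and m: "int p = 8 * i + 3" using i h p by auto
    have "int p mod 8 = 3" unfolding m by simp
    thus ?thesis using L n by (simp add: chi8_def)
  next
    assume h: "h = 4 * i + 2"
    have n: "nat (h - h div 2) = 2 * nat i + 1" and m: "int p = 8 * i + 5" using i h p by auto
    have "int p mod 8 = 5" unfolding m by simp
    thus ?thesis using L n by (simp add: chi8_def)
  next
    assume h: "h = 4 * i + 3"
    have n: "nat (h - h div 2) = 2 * (nat i + 1)" and m: "int p = 8 * i + 7" using i h p by auto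
    have "int p mod 8 = 7" unfolding m by simp
    thus ?thesis using L n by (simp add: chi8_def)
  qed
qed

text \<open>The function \<open>a \<mapsto> Legendre a q\<close>, corrected for \<open>q mod 4 = 3\<close> so that its value at
  a prime \<open>p\<close> is \<open>Legendre q p\<close>.\<close>

definition prime_factor_character :: "nat \<Rightarrow> int \<Rightarrow> int" where
  "prime_factor_character q a =
     (if q = 2 then chi8 a else if q mod 4 = 1 then Legendre a (int q) else chi4 a * Legendre a (int q))"

lemma prime_factor_character_mult:
  assumes "prime q"
  shows "prime_factor_character q (a * b) = prime_factor_character q a * prime_factor_character q b"
proof (cases "q = 2")
  case False
  hence "q > 2" using assms prime_ge_2_nat[of q] by simp
  thus ?thesis using assms by (simp add: prime_factor_character_def chi8_mult chi4_mult Legendre_mult)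
qed (simp add: prime_factor_character_def chi8_mult)

lemma prime_factor_character_minus_1:
  assumes "prime q"
  shows "prime_factor_character q (-1) = 1"
proof (cases "q = 2")
  case False
  hence "q > 2" using assms prime_ge_2_nat[of q] by simp
  thus ?thesis using assms Legendre_minus_1[of q] by (simp add: prime_factor_character_def chi4_def)
qed (simp add: prime_factor_character_def chi8_def)

lemma prime_factor_character_cong:
  assumes "[a = b] (mod (4 * int q))"
  shows "prime_factor_character q a = prime_factor_character q b"
proof -
  have "[a = b] (mod 4)" "[a = b] (mod int q)"
    using assms cong_dvd_modulus[OF assms] by auto
  moreover have "[a = b] (mod 8)" if "q = 2" using assms that by simp
  ultimately have "Legendre a (int q) = Legendre b (int q)" "chi4 a = chi4 b" "q = 2 \<Longrightarrow> chi8 a = chi8 b"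
    by (auto simp: chi4_def chi8_def cong_def[of _ _ 4] cong_def[of _ _ 8] intro!: Legendre_cong)
  thus ?thesis by (simp add: prime_factor_character_def)
qed

lemma prime_factor_character_values:
  "odd a \<Longrightarrow> \<not> int q dvd a \<Longrightarrow> prime_factor_character q a \<in> {-1, 1}"
  using Legendre_values[of a q] Legendre_eq_0_iff[of a q] chi4_odd[of a] chi8_odd[of a]
  unfolding prime_factor_character_def by auto

lemma prime_factor_character_prime:
  assumes q: "prime q" and p: "prime p" "p > 2" "p \<noteq> q"
  shows "prime_factor_character q (int p) = Legendre (int q) (int p)"
proof (cases "q = 2")
  case True
  thus ?thesis using Legendre_2[OF p(1,2)] by (simp add: prime_factor_character_def)
next
  case False
  hence q2: "q > 2" using q prime_ge_2_nat[of q] by simp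
  have odd: "odd q" "odd p" using q q2 p prime_odd_nat by blast+
  have rec: "Legendre (int p) (int q) * Legendre (int q) (int p) = (-1) ^ ((p - 1) div 2 * ((q - 1) div 2))"
    using Quadratic_Reciprocity[OF p(1,2) q q2 p(3)] .
  have "\<not> int p dvd int q" using p q primes_dvd_imp_eq by auto
  hence L: "Legendre (int q) (int p) = 1 \<or> Legendre (int q) (int p) = -1"
    using Legendre_values[of "int q" "int p"] Legendre_eq_0_iff[of "int q" "int p"] by auto
  hence rec': "Legendre (int p) (int q) = (-1) ^ ((p - 1) div 2 * ((q - 1) div 2)) * Legendre (int q) (int p)"
    using rec by auto
  have "q mod 4 = 1 \<or> q mod 4 = 3" "p mod 4 = 1 \<or> p mod 4 = 3" using odd by presburger+
  moreover have "even ((q - 1) div 2)" if "q mod 4 = 1" using that by presburger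
  moreover have "odd ((q - 1) div 2)" if "q mod 4 = 3" using that by presburger
  moreover have "even ((p - 1) div 2)" if "p mod 4 = 1" using that by presburger
  moreover have "odd ((p - 1) div 2)" if "p mod 4 = 3" using that by presburger
  moreover have "int p mod 4 = int (p mod 4)" by (simp add: zmod_int)
  ultimately show ?thesis using rec' False odd(2) by (auto simp: prime_factor_character_def chi4_def)
qed

text \<open>The product of \<open>prime_factor_character\<close> over the prime factors of
  \<open>K\<close>, with multiplicity, extends the Legendre symbol of \<open>K\<close> at primes to
  a periodic multiplicative function. Its values at integers not coprime to \<open>4 * K\<close> are
  left open and replaced by 0 in \<open>exists_discriminant_character\<close>.\<close>

lemma exists_Jacobi_character:
  assumes "K > (0::nat)"
  shows "\<exists>\<phi>. (\<forall>a b. \<phi> (a * b) = \<phi> a * \<phi> b) \<and> (\<forall>a b. [a = b] (mod (4 * int K)) \<longrightarrow> \<phi> a = \<phi> b) \<and>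
    (\<forall>a. coprime a (4 * int K) \<longrightarrow> \<phi> a \<in> {-1, 1}) \<and> \<phi> (-1) = (1::int) \<and>
    (\<forall>p. prime p \<longrightarrow> p > 2 \<longrightarrow> \<not> p dvd K \<longrightarrow> \<phi> (int p) = Legendre (int K) (int p))"
  using assms
proof (induction K rule: prime_divisors_induct)
  case (unit K)
  have "Legendre 1 (int p) = 1" if "prime p" for p
  proof -
    have "QuadRes (int p) 1" unfolding QuadRes_def by (intro exI[of _ 1]) simp
    moreover have "\<not> int p dvd 1" using that prime_gt_1_nat[of p] by simp
    ultimately show ?thesis by (simp add: Legendre_def cong_0_iff)
  qed
  thus ?case using unit by (intro exI[of _ "\<lambda>_. 1"]) simp
next
  case (factor q K)
  hence q: "prime q" and K: "K > 0" by auto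
  obtain \<phi> where \<phi>: "\<And>a b. \<phi> (a * b) = \<phi> a * \<phi> b" "\<And>a b. [a = b] (mod (4 * int K)) \<Longrightarrow> \<phi> a = \<phi> b"
    "\<And>a. coprime a (4 * int K) \<Longrightarrow> \<phi> a \<in> {-1, 1}" "\<phi> (-1) = (1::int)"
    "\<And>p. prime p \<Longrightarrow> p > 2 \<Longrightarrow> \<not> p dvd K \<Longrightarrow> \<phi> (int p) = Legendre (int K) (int p)"
    using factor.IH[OF K] by blast
  define \<phi>' where "\<phi>' a = prime_factor_character q a * \<phi> a" for a
  show ?case
  proof (intro exI[of _ \<phi>'] conjI allI impI)
    show "\<phi>' (a * b) = \<phi>' a * \<phi>' b" for a b
      by (simp add: \<phi>'_def \<phi>(1) prime_factor_character_mult[OF q])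
    show "\<phi>' a = \<phi>' b" if "[a = b] (mod (4 * int (q * K)))" for a b
    proof -
      have "[a = b] (mod (4 * int q))" "[a = b] (mod (4 * int K))"
        using that by (auto elim!: cong_dvd_modulus)
      thus ?thesis using \<phi>(2) prime_factor_character_cong by (simp add: \<phi>'_def)
    qed
    show "\<phi>' a \<in> {-1, 1}" if cop: "coprime a (4 * int (q * K))" for a
    proof -
      have c: "coprime a (4 * int K)" "coprime a (int q)" "coprime a 4" using cop by auto
      have "odd a" using c(3) by (metis coprime_common_divisor even_numeral odd_one)
      moreover have "\<not> int q dvd a"
        using c(2) q by (metis coprime_common_divisor dvd_refl not_prime_unit prime_nat_int_transfer)
      ultimately show ?thesis
        using prime_factor_character_values[of a q] \<phi>(3)[OF c(1)] by (auto simp: \<phi>'_def)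
    qed
    show "\<phi>' (-1) = 1" by (simp add: \<phi>'_def \<phi>(4) prime_factor_character_minus_1[OF q])
    show "\<phi>' (int p) = Legendre (int (q * K)) (int p)" if p: "prime p" "p > 2" "\<not> p dvd q * K" for p
    proof -
      have "p \<noteq> q" "\<not> p dvd K" using p(3) by auto
      thus ?thesis using p q by (simp add: \<phi>'_def prime_factor_character_prime \<phi>(5) Legendre_mult)
    qed
  qed
qed (use assms in auto)

text \<open>The factor \<open>chi4\<close> turns \<open>K\<close> into \<open>- K\<close> and makes
  the character odd. Oddness reflects the negative discriminant and is what later puts
  \<open>- int q\<close> into the kernel.\<close>

lemma exists_discriminant_character:
  assumes "K > (0::nat)"
  obtains \<phi> where "real_character (4 * int K) \<phi>" "\<phi> (-1) = -1"
    "\<And>p. prime p \<Longrightarrow> p > 2 \<Longrightarrow> \<not> p dvd K \<Longrightarrow> \<phi> (int p) = Legendre (- int K) (int p)"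
proof -
  define M where "M = 4 * int K"
  obtain \<phi> where \<phi>: "\<And>a b. \<phi> (a * b) = \<phi> a * \<phi> b" "\<And>a b. [a = b] (mod M) \<Longrightarrow> \<phi> a = \<phi> b"
    "\<And>a. coprime a M \<Longrightarrow> \<phi> a \<in> {-1, 1}" "\<phi> (-1) = (1::int)"
    "\<And>p. prime p \<Longrightarrow> p > 2 \<Longrightarrow> \<not> p dvd K \<Longrightarrow> \<phi> (int p) = Legendre (int K) (int p)"
    using exists_Jacobi_character[OF assms] unfolding M_def by blast
  define \<phi>' where "\<phi>' a = (if coprime a M then chi4 a * \<phi> a else 0)" for a
  have odd: "odd a" if "coprime a M" for a
  proof
    assume "even a"
    moreover have "even M" by (simp add: M_def)
    ultimately show False using that by (metis coprime_common_divisor odd_one)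
  qed
  have mod: "chi4 (a mod M) = chi4 a" for a
  proof -
    have "a mod M mod 4 = a mod 4" by (simp add: M_def mod_mod_cancel)
    thus ?thesis by (metis chi4_mod)
  qed
  have "real_character M \<phi>'"
    unfolding real_character_def
  proof (intro conjI allI)
    show "M > 0" using assms by (simp add: M_def)
    show "\<phi>' (a * b) = \<phi>' a * \<phi>' b" for a b by (simp add: \<phi>'_def \<phi>(1) chi4_mult)
    show "\<phi>' (a mod M) = \<phi>' a" for a
      using \<phi>(2)[of "a mod M" a] mod[of a] assms coprime_mod_left_iff[of M a]
      by (simp add: \<phi>'_def cong_def M_def)
    show "\<phi>' a \<in> {-1, 0, 1}" for a using \<phi>(3)[of a] odd[of a] chi4_odd[of a] by (auto simp: \<phi>'_def)
    show "\<phi>' a = 0 \<longleftrightarrow> \<not> coprime a M" for a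
      using \<phi>(3)[of a] odd[of a] chi4_odd[of a] by (auto simp: \<phi>'_def)
  qed
  moreover have "\<phi>' (-1) = -1" using \<phi>(4) by (simp add: \<phi>'_def chi4_def)
  moreover have "\<phi>' (int p) = Legendre (- int K) (int p)" if p: "prime p" "p > 2" "\<not> p dvd K" for p
  proof -
    have po: "odd p" using p prime_odd_nat by blast
    have "coprime p 2" using po by simp
    hence "coprime p (2 * 2)" by (simp only: coprime_mult_right_iff)
    hence "coprime p (4 * K)" using p(1,3) prime_imp_coprime[of p K] by simp
    hence "coprime (int p) M" unfolding M_def by (metis coprime_int_iff of_nat_mult of_nat_numeral)
    moreover have "chi4 (int p) = Legendre (-1) (int p)"
    proof -
      have "int p mod 4 = int (p mod 4)" by (simp add: zmod_int)
      moreover have "p mod 4 = 1 \<or> p mod 4 = 3" using po by presburger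
      ultimately show ?thesis using Legendre_minus_1[OF p(1,2)] by (auto simp: chi4_def)
    qed
    ultimately show ?thesis using \<phi>(5)[OF p] Legendre_mult[OF p(1,2), of "-1" "int K"] by (simp add: \<phi>'_def)
  qed
  ultimately show ?thesis using that unfolding M_def by blast
qed

section \<open>Residues generated by squares and split primes\<close>

text \<open>The primes in \<open>S\<close> are distinct, so that square roots modulo each of them
  can be combined by the Chinese remainder theorem; the square absorbs repeated primes and makes the
  set closed under products.\<close>

definition split_part :: "int \<Rightarrow> (int \<Rightarrow> int) \<Rightarrow> int set" where
  "split_part M \<phi> = {a. \<exists>S \<tau>. finite S \<and> (\<forall>p\<in>S. prime p \<and> \<phi> (int p) = 1) \<and> coprime \<tau> M \<and>
     [a = int (\<Prod>S) * \<tau>\<^sup>2] (mod M)}"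

lemma split_partI:
  assumes "finite S" "\<And>p. p \<in> S \<Longrightarrow> prime p \<and> \<phi> (int p) = 1" "coprime \<tau> M" "[a = int (\<Prod>S) * \<tau>\<^sup>2] (mod M)"
  shows "a \<in> split_part M \<phi>"
  using assms unfolding split_part_def by blast

lemma split_part_square: "coprime \<tau> M \<Longrightarrow> \<tau>\<^sup>2 \<in> split_part M \<phi>"
  by (rule split_partI[of "{}" _ \<tau>]) simp_all

lemma split_part_prime: "prime p \<Longrightarrow> \<phi> (int p) = 1 \<Longrightarrow> int p \<in> split_part M \<phi>"
  by (rule split_partI[of "{p}" _ 1]) simp_all

lemma split_part_cong: "a \<in> split_part M \<phi> \<Longrightarrow> [b = a] (mod M) \<Longrightarrow> b \<in> split_part M \<phi>"
  unfolding split_part_def mem_Collect_eq by (meson cong_trans)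

lemma coprime_prod_split_primes:
  assumes \<phi>: "real_character M \<phi>" and "\<And>p. p \<in> S \<Longrightarrow> \<phi> (int p) = 1"
  shows "coprime (int (\<Prod>S)) M"
proof -
  have "coprime (int p) M" if "p \<in> S" for p
    using assms(2)[OF that] real_characterD(5)[OF \<phi>, of "int p"] by auto
  thus ?thesis by (simp add: prod_coprime_left)
qed

lemma split_part_coprime:
  assumes \<phi>: "real_character M \<phi>" and "a \<in> split_part M \<phi>"
  shows "coprime a M"
proof -
  obtain S \<tau> where S: "\<forall>p\<in>S. prime p \<and> \<phi> (int p) = 1" "coprime \<tau> M" "[a = int (\<Prod>S) * \<tau>\<^sup>2] (mod M)"
    using assms(2) unfolding split_part_def by blast
  have "coprime (int (\<Prod>S) * \<tau>\<^sup>2) M"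
    using coprime_prod_split_primes[OF \<phi>, of S] S by (simp del: of_nat_prod)
  thus ?thesis using S(3) cong_imp_coprime cong_sym by blast
qed

lemma split_part_mult:
  assumes \<phi>: "real_character M \<phi>" and a: "a \<in> split_part M \<phi>" and b: "b \<in> split_part M \<phi>"
  shows "a * b \<in> split_part M \<phi>"
proof -
  obtain S \<sigma> where S: "finite S" "\<forall>p\<in>S. prime p \<and> \<phi> (int p) = 1" "coprime \<sigma> M" "[a = int (\<Prod>S) * \<sigma>\<^sup>2] (mod M)"
    using a unfolding split_part_def by blast
  obtain T \<tau> where T: "finite T" "\<forall>p\<in>T. prime p \<and> \<phi> (int p) = 1" "coprime \<tau> M" "[b = int (\<Prod>T) * \<tau>\<^sup>2] (mod M)"
    using b unfolding split_part_def by blast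
  define D where "D = (S - T) \<union> (T - S)"
  define I where "I = int (\<Prod>(S \<inter> T))"
  have "\<Prod>S = \<Prod>(S - T) * \<Prod>(S \<inter> T)" "\<Prod>T = \<Prod>(T - S) * \<Prod>(S \<inter> T)"
    using S(1) T(1) prod.Int_Diff[of S "\<lambda>x. x" T] prod.Int_Diff[of T "\<lambda>x. x" S]
    by (simp_all add: mult.commute Int_commute)
  moreover have "\<Prod>D = \<Prod>(S - T) * \<Prod>(T - S)"
    unfolding D_def using S(1) T(1) by (intro prod.union_disjoint) auto
  ultimately have eq: "int (\<Prod>S) * int (\<Prod>T) = int (\<Prod>D) * I\<^sup>2"
    unfolding I_def by (simp only: of_nat_mult power2_eq_square mult_ac)
  have "coprime I M" unfolding I_def using S(2) by (intro coprime_prod_split_primes[OF \<phi>]) auto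
  hence cop: "coprime (I * \<sigma> * \<tau>) M" using S(3) T(3) by simp
  have "[a * b = (int (\<Prod>S) * \<sigma>\<^sup>2) * (int (\<Prod>T) * \<tau>\<^sup>2)] (mod M)"
    using S(4) T(4) by (rule cong_mult)
  also have "(int (\<Prod>S) * \<sigma>\<^sup>2) * (int (\<Prod>T) * \<tau>\<^sup>2) = (int (\<Prod>S) * int (\<Prod>T)) * (\<sigma> * \<tau>)\<^sup>2"
    by (simp only: power_mult_distrib mult_ac)
  also have "\<dots> = int (\<Prod>D) * (I * \<sigma> * \<tau>)\<^sup>2"
    unfolding eq by (simp only: power_mult_distrib mult_ac)
  finally show ?thesis
    using S T cop by (intro split_partI[of D _ "I * \<sigma> * \<tau>"]) (auto simp: D_def)
qed

lemma coprime_inverse_mod: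
  fixes a M :: int
  assumes "coprime a M"
  obtains a' where "[a * a' = 1] (mod M)" "coprime a' M"
proof -
  obtain a' where a': "[a * a' = 1] (mod M)" using cong_solve_coprime_int[OF assms] by blast
  hence "coprime (a * a') M" using cong_imp_coprime[OF cong_sym[OF a']] by simp
  thus ?thesis using a' that by simp
qed

text \<open>A maximal group of residues that contains \<open>split_part M \<phi>\<close> but not \<open>r\<close> has index 2, so it is
  the kernel of a real character \<open>\<psi>\<close>; no prime can then separate \<open>\<phi>\<close> from \<open>\<psi>\<close>.\<close>

theorem split_part_eq_kernel:
  assumes \<phi>: "real_character M \<phi>" and r: "\<phi> r = 1"
  shows "r \<in> split_part M \<phi>"
proof (rule ccontr)
  assume notin: "r \<notin> split_part M \<phi>"
  have M: "M > 0" using real_characterD(1)[OF \<phi>] .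
  have rM: "coprime r M" using r real_characterD(5)[OF \<phi>, of r] by auto
  define P where "P H \<longleftrightarrow> split_part M \<phi> \<subseteq> H \<and> (\<forall>a\<in>H. coprime a M) \<and> (\<forall>a\<in>H. \<forall>b\<in>H. a * b \<in> H) \<and>
    (\<forall>a\<in>H. \<forall>b. [b = a] (mod M) \<longrightarrow> b \<in> H) \<and> r \<notin> H" for H
  \<comment> \<open>\<open>H\<close> is an infinite set of integers; counting its residues gives a
    bounded quantity to maximise.\<close>
  define size where "size H = card (H \<inter> {0..<M})" for H
  have P0: "P (split_part M \<phi>)"
    unfolding P_def using split_part_coprime[OF \<phi>] split_part_mult[OF \<phi>] split_part_cong notin by blast
  have bound: "\<forall>H. P H \<longrightarrow> size H < Suc (nat M)"
  proof (intro allI impI)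
    fix H
    have "size H \<le> card {0..<M}" unfolding size_def by (intro card_mono) auto
    thus "size H < Suc (nat M)" by simp
  qed
  obtain H where H: "P H" and max: "\<And>H'. P H' \<Longrightarrow> size H' \<le> size H"
    using ex_has_greatest_nat[OF P0 bound] by blast
  have H0: "a \<in> H" if "a \<in> split_part M \<phi>" for a using H that unfolding P_def by blast
  have Hcop: "coprime a M" if "a \<in> H" for a using H that unfolding P_def by blast
  have Hmult: "a * b \<in> H" if "a \<in> H" "b \<in> H" for a b using H that unfolding P_def by blast
  have Hcong: "b \<in> H" if "a \<in> H" "[b = a] (mod M)" for a b using H that unfolding P_def by blast
  have rH: "r \<notin> H" using H unfolding P_def by blast
  have Hsq: "a * a \<in> H" if "coprime a M" for a
    using H0[OF split_part_square[OF that]] by (simp add: power2_eq_square)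
  \<comment> \<open>An inverse of \<open>a\<close> is \<open>a\<close> times the square
    \<open>a' * a'\<close>, and squares of units lie in \<open>H\<close>.\<close>
  have cancel: "b \<in> H" if a: "a \<in> H" and ab: "a * b \<in> H" for a b
  proof -
    obtain a' where a': "[a * a' = 1] (mod M)" "coprime a' M" using coprime_inverse_mod Hcop[OF a] by blast
    have "(a * b) * a * (a' * a') \<in> H" using Hmult Hsq[OF a'(2)] a ab by blast
    moreover have "[(a * a') * (a * a') * b = 1 * 1 * b] (mod M)"
      by (intro cong_mult a'(1) cong_refl)
    hence "[b = (a * b) * a * (a' * a')] (mod M)" by (simp add: mult_ac cong_sym_eq)
    ultimately show ?thesis using Hcong by blast
  qed
  \<comment> \<open>Adjoining \<open>g\<close> enlarges \<open>H\<close> and keeps every closure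
    condition, so by maximality it must bring in \<open>r\<close>. Hence all units outside
    \<open>H\<close> lie in the coset of \<open>r\<close>.\<close>
  have coset: "\<exists>h\<in>H. [r = g * h] (mod M)" if g: "coprime g M" "g \<notin> H" for g
  proof (rule ccontr)
    assume neg: "\<not> ?thesis"
    define H' where "H' = H \<union> {x. \<exists>h\<in>H. [x = g * h] (mod M)}"
    have one: "1 \<in> H" using Hsq[of 1] by simp
    have "P H'"
      unfolding P_def
    proof (intro conjI ballI allI impI)
      show "split_part M \<phi> \<subseteq> H'" using H0 unfolding H'_def by blast
      show "coprime a M" if aH: "a \<in> H'" for a
      proof (cases "a \<in> H")
        case False
        then obtain h where h: "h \<in> H" "[a = g * h] (mod M)" using aH unfolding H'_def by blast
        hence "coprime (g * h) M" using g Hcop by simp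
        thus ?thesis using cong_imp_coprime[OF cong_sym[OF h(2)]] by blast
      qed (use Hcop in blast)
      show "a * b \<in> H'" if "a \<in> H'" "b \<in> H'" for a b
      proof -
        consider "a \<in> H" "b \<in> H" | h where "h \<in> H" "[a = g * h] (mod M)" "b \<in> H"
          | k where "a \<in> H" "k \<in> H" "[b = g * k] (mod M)"
          | h k where "h \<in> H" "[a = g * h] (mod M)" "k \<in> H" "[b = g * k] (mod M)"
          using \<open>a \<in> H'\<close> \<open>b \<in> H'\<close> unfolding H'_def by blast
        thus ?thesis
        proof cases
          case 1 thus ?thesis using Hmult unfolding H'_def by blast
        next
          case (2 h)
          have "[a * b = g * (h * b)] (mod M)"
            using cong_mult[OF 2(2) cong_refl[of b M]] by (simp add: mult.assoc)
          thus ?thesis using Hmult[OF 2(1,3)] unfolding H'_def by blast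
        next
          case (3 k)
          have "[a * b = g * (a * k)] (mod M)"
            using cong_mult[OF cong_refl[of a M] 3(3)] by (simp add: mult_ac)
          thus ?thesis using Hmult[OF 3(1,2)] unfolding H'_def by blast
        next
          case (4 h k)
          have "[a * b = (g * g) * (h * k)] (mod M)"
            using cong_mult[OF 4(2,4)] by (simp add: mult_ac)
          moreover have "(g * g) * (h * k) \<in> H" using Hmult Hsq g(1) 4 by blast
          ultimately show ?thesis using Hcong unfolding H'_def by blast
        qed
      qed
      show "b \<in> H'" if "a \<in> H'" "[b = a] (mod M)" for a b
        using that Hcong cong_trans unfolding H'_def by blast
      show "r \<notin> H'" using rH neg unfolding H'_def by blast
    qed
    moreover have "size H < size H'"
      unfolding size_def
    proof (rule psubset_card_mono)
      have gg: "[g mod M = g] (mod M)" by (simp add: cong_def)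
      have "g mod M \<in> H'" using one gg unfolding H'_def by (intro UnI2 CollectI bexI[of _ 1]) simp_all
      moreover have "g mod M \<notin> H" using Hcong[of "g mod M" g] g(2) gg cong_sym by blast
      moreover have "g mod M \<in> {0..<M}" using M by simp
      ultimately show "H \<inter> {0..<M} \<subset> H' \<inter> {0..<M}" unfolding H'_def by blast
    qed simp
    ultimately show False using max[of H'] by simp
  qed
  define \<psi> where "\<psi> a = (if a \<in> H then 1 else if coprime a M then -1 else 0 :: int)" for a
  have \<psi>: "real_character M \<psi>"
    unfolding real_character_def
  proof (intro conjI allI)
    show "M > 0" by (rule M)
    show "\<psi> (a mod M) = \<psi> a" for a
    proof -
      have "a mod M \<in> H \<longleftrightarrow> a \<in> H" using Hcong[of a "a mod M"] Hcong[of "a mod M" a] by (auto simp: cong_def)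
      thus ?thesis using M by (simp add: \<psi>_def)
    qed
    show "\<psi> a \<in> {-1, 0, 1}" for a by (simp add: \<psi>_def)
    show "\<psi> a = 0 \<longleftrightarrow> \<not> coprime a M" for a using Hcop by (auto simp: \<psi>_def)
    show "\<psi> (a * b) = \<psi> a * \<psi> b" for a b
    proof (cases "coprime a M \<and> coprime b M")
      case False
      hence "\<not> coprime (a * b) M" by simp
      thus ?thesis using False Hcop[of a] Hcop[of b] Hcop[of "a * b"] by (auto simp: \<psi>_def)
    next
      case True
      consider "a \<in> H" "b \<in> H" | "a \<in> H" "b \<notin> H" | "a \<notin> H" "b \<in> H" | "a \<notin> H" "b \<notin> H" by blast
      thus ?thesis
      proof cases
        case 1 thus ?thesis using Hmult by (simp add: \<psi>_def)
      next
        case 2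
        hence "a * b \<notin> H" using cancel by blast
        thus ?thesis using 2 True by (simp add: \<psi>_def)
      next
        case 3
        hence "a * b \<notin> H" using cancel[of b a] by (auto simp: mult.commute)
        thus ?thesis using 3 True by (simp add: \<psi>_def)
      next
        case 4
        obtain h where h: "h \<in> H" "[r = a * h] (mod M)" using coset True 4(1) by blast
        obtain k where k: "k \<in> H" "[r = b * k] (mod M)" using coset True 4(2) by blast
        have "[(h * k) * (a * b) = r * r] (mod M)"
          using cong_sym[OF cong_mult[OF h(2) k(2)]] by (simp add: mult_ac)
        hence "(h * k) * (a * b) \<in> H" using Hcong[OF Hsq[OF rM]] by blast
        hence "a * b \<in> H" using cancel Hmult[OF h(1) k(1)] by blast
        thus ?thesis using 4 True by (simp add: \<psi>_def)
      qed
    qed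
  qed
  have "\<psi> r = -1" using rH rM by (simp add: \<psi>_def)
  \<comment> \<open>Since \<open>\<phi> r = 1\<close>, the same \<open>r\<close> also shows that the
    product of the two characters is not principal.\<close>
  then obtain p where p: "prime p" "\<phi> (int p) = 1" "\<psi> (int p) = -1"
    using exists_prime_with_character_values[OF \<phi> \<psi>, of r r] r by auto
  have "int p \<in> H" using H0 split_part_prime p by blast
  thus False using p(3) by (simp add: \<psi>_def)
qed


lemma product_dvd_square_plus:
  fixes D :: int
  assumes "finite S" "\<And>p. p \<in> S \<Longrightarrow> prime p \<and> (\<exists>y. int p dvd y\<^sup>2 + D)"
  shows "\<exists>X. int (\<Prod>S) dvd X\<^sup>2 + D"
  using assms
proof (induction S rule: finite_induct)
  case (insert p S)
  obtain X where X: "int (\<Prod>S) dvd X\<^sup>2 + D" using insert by blast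
  obtain y where y: "int p dvd y\<^sup>2 + D" using insert by blast
  have "coprime p (\<Prod>S)"
    using insert by (intro prod_coprime_right) (metis insertCI primes_coprime)
  hence cop: "coprime (int p) (int (\<Prod>S))" by (simp only: coprime_int_iff)
  obtain x where x: "[x = y] (mod int p)" "[x = X] (mod int (\<Prod>S))"
    using binary_chinese_remainder_int[OF cop] by blast
  have "int p dvd x\<^sup>2 + D"
    using y by (simp only: cong_0_iff[symmetric]) (rule cong_trans[OF cong_add[OF cong_pow[OF x(1)] cong_refl]])
  moreover have "int (\<Prod>S) dvd x\<^sup>2 + D"
    using X by (simp only: cong_0_iff[symmetric]) (rule cong_trans[OF cong_add[OF cong_pow[OF x(2)] cong_refl]])
  ultimately have "int p * int (\<Prod>S) dvd x\<^sup>2 + D" using cop by (rule divides_mult)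
  moreover have "int (\<Prod>(insert p S)) = int p * int (\<Prod>S)" using insert(1,2) by simp
  ultimately show ?case by (intro exI[of _ x]) (simp only:)
qed simp

text \<open>Both \<open>-1\<close> and \<open>q\<close> have character value \<open>-1\<close>, so
  \<open>- q\<close> lies in the kernel and is congruent to \<open>m * \<tau>\<^sup>2\<close> with
  \<open>m\<close> a product of distinct split primes. Modulo each of them \<open>- K\<close> is a
  square, and \<open>X\<close> combines the roots.\<close>

lemma exists_multiplier:
  assumes K: "K > (0::nat)" and q: "prime q" "q > 2" "\<not> q dvd K" "Legendre (- int K) (int q) = -1"
  obtains m \<tau> X :: int where "m > 0" "4 * int K dvd m * \<tau>\<^sup>2 + int q" "m dvd X\<^sup>2 + int K"
proof -
  obtain \<phi> where \<phi>: "real_character (4 * int K) \<phi>" "\<phi> (-1) = -1"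
    and prime: "\<And>p. prime p \<Longrightarrow> p > 2 \<Longrightarrow> \<not> p dvd K \<Longrightarrow> \<phi> (int p) = Legendre (- int K) (int p)"
    using exists_discriminant_character[OF K] by blast
  have "\<phi> (- int q) = \<phi> (-1) * \<phi> (int q)" using real_characterD(2)[OF \<phi>(1), of "-1" "int q"] by simp
  hence "\<phi> (- int q) = 1" using \<phi>(2) prime[OF q(1-3)] q(4) by simp
  hence "- int q \<in> split_part (4 * int K) \<phi>" by (rule split_part_eq_kernel[OF \<phi>(1)])
  then obtain S \<tau> where S: "finite S" "\<forall>p\<in>S. prime p \<and> \<phi> (int p) = 1"
    "[- int q = int (\<Prod>S) * \<tau>\<^sup>2] (mod 4 * int K)"
    unfolding split_part_def by blast
  have "\<exists>y. int p dvd y\<^sup>2 + int K" if p: "p \<in> S" for p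
  proof -
    have "coprime (int p) (4 * int K)" using S(2) p real_characterD(5)[OF \<phi>(1), of "int p"] by auto
    hence "coprime (int p) (int (4 * K))" by simp
    hence cop: "coprime p (4 * K)" by (simp only: coprime_int_iff)
    have pp: "prime p" using S(2) p by blast
    have "p \<noteq> 2"
    proof
      assume "p = 2"
      hence "p dvd 4 * K" by simp
      thus False using cop pp by (metis coprime_common_divisor dvd_refl not_prime_unit)
    qed
    hence p2: "p > 2" using pp prime_ge_2_nat[of p] by simp
    have pK: "\<not> p dvd K" using cop pp by (metis coprime_common_divisor dvd_mult dvd_refl not_prime_unit)
    have "Legendre (- int K) (int p) = 1" using prime[OF pp p2 pK] S(2) p by simp
    hence "QuadRes (int p) (- int K)" by (auto simp: Legendre_def split: if_splits)
    then obtain y where "[y\<^sup>2 = - int K] (mod int p)" unfolding QuadRes_def by blast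
    thus ?thesis by (intro exI[of _ y]) (simp add: cong_iff_dvd_diff)
  qed
  then obtain X where X: "int (\<Prod>S) dvd X\<^sup>2 + int K"
    using product_dvd_square_plus[of S "int K"] S by blast
  have "\<Prod>S > 0" using S(2) by (intro prod_pos) (auto simp: prime_gt_0_nat)
  hence "int (\<Prod>S) > 0" by (simp only: of_nat_0_less_iff)
  moreover have "4 * int K dvd int (\<Prod>S) * \<tau>\<^sup>2 + int q"
    using cong_sym[OF S(3)] unfolding cong_iff_dvd_diff by simp
  ultimately show ?thesis using X by (rule that)
qed

section \<open>Ternary forms\<close>

definition ternary_form :: "int \<Rightarrow> int \<Rightarrow> int \<Rightarrow> int \<Rightarrow> int \<Rightarrow> int \<Rightarrow> int \<Rightarrow> int \<Rightarrow> int \<Rightarrow> int" where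
  "ternary_form a b c r s t x y z = a * x\<^sup>2 + b * y\<^sup>2 + c * z\<^sup>2 + r * y * z + s * x * z + t * x * y"

text \<open>Half the determinant of the Hessian matrix, which is integral also when mixed
  coefficients are odd.\<close>

definition ternary_disc :: "int \<Rightarrow> int \<Rightarrow> int \<Rightarrow> int \<Rightarrow> int \<Rightarrow> int \<Rightarrow> int" where
  "ternary_disc a b c r s t = 4 * a * b * c + r * s * t - a * r\<^sup>2 - b * s\<^sup>2 - c * t\<^sup>2"

text \<open>Bundles three properties invariant under unimodular substitutions. As only the value
  \<open>n\<close> has to survive reduction, no equivalence relation between forms is
  introduced.\<close>

definition represented :: "int \<Rightarrow> int \<Rightarrow> int \<Rightarrow> int \<Rightarrow> int \<Rightarrow> int \<Rightarrow> int \<Rightarrow> int \<Rightarrow> bool" where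
  "represented D n a b c r s t \<longleftrightarrow> ternary_disc a b c r s t = D \<and>
     (\<forall>x y z. (x, y, z) \<noteq> (0, 0, 0) \<longrightarrow> ternary_form a b c r s t x y z > 0) \<and>
     (\<exists>x y z. ternary_form a b c r s t x y z = n)"

lemma represented_swap12: "represented D n a b c r s t \<Longrightarrow> represented D n b a c s r t"
proof -
  assume R: "represented D n a b c r s t"
  have eq: "ternary_form b a c s r t x y z = ternary_form a b c r s t y x z" for x y z
    by (simp add: ternary_form_def algebra_simps)
  have "ternary_disc b a c s r t = ternary_disc a b c r s t" by (simp add: ternary_disc_def algebra_simps)
  thus ?thesis using R unfolding represented_def eq by auto
qed

lemma represented_swap23: "represented D n a b c r s t \<Longrightarrow> represented D n a c b r t s"
proof -
  assume R: "represented D n a b c r s t"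
  have eq: "ternary_form a c b r t s x y z = ternary_form a b c r s t x z y" for x y z
    by (simp add: ternary_form_def algebra_simps)
  have "ternary_disc a c b r t s = ternary_disc a b c r s t" by (simp add: ternary_disc_def algebra_simps)
  thus ?thesis using R unfolding represented_def eq by auto
qed

lemma represented_shift:
  assumes R: "represented D n a b c r s t"
  shows "represented D n a b (c + i\<^sup>2 * a + j\<^sup>2 * b + i * s + j * r + i * j * t)
           (r + i * t + 2 * j * b) (s + 2 * i * a + j * t) t" (is "represented D n a b ?c ?r ?s t")
proof -
  have eq: "ternary_form a b ?c ?r ?s t x y z = ternary_form a b c r s t (x + i * z) (y + j * z) z" for x y z
    by (simp add: ternary_form_def algebra_simps power2_eq_square)
  have disc: "ternary_disc a b ?c ?r ?s t = ternary_disc a b c r s t"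
    by (simp add: ternary_disc_def algebra_simps power2_eq_square)
  obtain x y z where n: "ternary_form a b c r s t x y z = n" using R unfolding represented_def by blast
  have "ternary_form a b ?c ?r ?s t (x - i * z) (y - j * z) z = n" unfolding eq using n by simp
  moreover have "ternary_form a b ?c ?r ?s t x y z > 0" if "(x, y, z) \<noteq> (0, 0, 0)" for x y z
  proof -
    have "(x + i * z, y + j * z, z) \<noteq> (0, 0, 0)" using that by auto
    thus ?thesis using R unfolding represented_def eq by blast
  qed
  ultimately show ?thesis using R unfolding represented_def disc by blast
qed

lemma represented_pos:
  assumes "represented D n a b c r s t"
  shows "a > 0" "b > 0" "c > 0"
proof -
  have pos: "ternary_form a b c r s t x y z > 0" if "(x, y, z) \<noteq> (0, 0, 0)" for x y z
    using assms that unfolding represented_def by blast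
  show "a > 0" "b > 0" "c > 0" using pos[of 1 0 0] pos[of 0 1 0] pos[of 0 0 1]
    by (simp_all add: ternary_form_def)
qed

section \<open>Reduction of positive ternary forms\<close>

text \<open>A form with least \<open>a + b + c\<close> among all those in
  \<open>represented D n\<close> will do: adding multiples of two basis vectors to the third cannot
  lower this trace, and the multiples \<open>-1\<close>, 0, 1 give the inequalities. Sorting the
  coefficients afterwards preserves the trace.\<close>

lemma exists_reduced:
  assumes "represented D n a b c r s t"
  obtains a b c r s t where "represented D n a b c r s t" "a \<le> b" "b \<le> c" "\<bar>t\<bar> \<le> a" "\<bar>s\<bar> \<le> a" "\<bar>r\<bar> \<le> b"
    "\<And>i j. i \<in> {-1, 1} \<Longrightarrow> j \<in> {-1, 1} \<Longrightarrow> a + b + i * s + j * r + i * j * t \<ge> 0"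
proof -
  define P where "P = (\<lambda>(a, b, c, r, s, t). represented D n a b c r s t)"
  have "P (a, b, c, r, s, t)" using assms by (simp add: P_def)
  then obtain u where u: "P u" "\<And>v. P v \<Longrightarrow> (\<lambda>(a, b, c, r, s, t). nat (a + b + c)) u \<le>
      (\<lambda>(a :: int, b :: int, c :: int, r :: int, s :: int, t :: int). nat (a + b + c)) v"
    using ex_has_least_nat[of P _ "\<lambda>(a, b, c, r, s, t). nat (a + b + c)"] by metis
  obtain a0 b0 c0 r0 s0 t0 where u0: "u = (a0, b0, c0, r0, s0, t0)" by (metis prod_cases6)
  define S where "S = a0 + b0 + c0"
  have R0: "represented D n a0 b0 c0 r0 s0 t0" using u(1) u0 by (simp add: P_def)
  have min: "S \<le> a + b + c" if "represented D n a b c r s t" for a b c r s t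
  proof -
    have "nat S \<le> nat (a + b + c)" using u(2)[of "(a, b, c, r, s, t)"] that u0 by (simp add: P_def S_def)
    thus ?thesis using represented_pos[OF that] by simp
  qed
  have "\<exists>a b c r s t. represented D n a b c r s t \<and> a + b + c = S \<and> a \<le> b \<and> b \<le> c"
  proof -
    have "\<exists>a b c r s t. represented D n a b c r s t \<and> a + b + c = S \<and> a \<le> b"
    proof (cases "a0 \<le> b0")
      case True thus ?thesis using R0 S_def by blast
    next
      case False
      hence "b0 + a0 + c0 = S" "b0 \<le> a0" by (auto simp: S_def)
      thus ?thesis using represented_swap12[OF R0] by blast
    qed
    then obtain a1 b1 c1 r1 s1 t1 where R1: "represented D n a1 b1 c1 r1 s1 t1" "a1 + b1 + c1 = S" "a1 \<le> b1"
      by blast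
    show ?thesis
    proof (cases "b1 \<le> c1")
      case True thus ?thesis using R1 by blast
    next
      case cb: False
      have R2: "represented D n a1 c1 b1 r1 t1 s1" by (rule represented_swap23[OF R1(1)])
      show ?thesis
      proof (cases "a1 \<le> c1")
        case True
        thus ?thesis using R2 R1(2) cb by (metis add.assoc add.commute linorder_le_cases)
      next
        case False
        have "represented D n c1 a1 b1 t1 r1 s1" by (rule represented_swap12[OF R2])
        moreover have "c1 + a1 + b1 = S" "c1 \<le> a1" using R1(2) False by auto
        ultimately show ?thesis using R1(3) by blast
      qed
    qed
  qed
  then obtain a b c r s t where R: "represented D n a b c r s t" "a + b + c = S" "a \<le> b" "b \<le> c" by blast
  have c: "i\<^sup>2 * a + j\<^sup>2 * b + i * s + j * r + i * j * t \<ge> 0" for i j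
    using min[OF represented_shift[OF R(1), of i j]] R(2) by simp
  have b: "i\<^sup>2 * a + j\<^sup>2 * c + i * t + j * r + i * j * s \<ge> 0" for i j
    using min[OF represented_shift[OF represented_swap23[OF R(1)], of i j]] R(2) by simp
  have "\<bar>t\<bar> \<le> a" using b[of 1 0] b[of "-1" 0] by simp
  moreover have "\<bar>s\<bar> \<le> a" using c[of 1 0] c[of "-1" 0] by simp
  moreover have "\<bar>r\<bar> \<le> b" using c[of 0 1] c[of 0 "-1"] by simp
  moreover have "a + b + i * s + j * r + i * j * t \<ge> 0" if "i \<in> {-1, 1}" "j \<in> {-1, 1}" for i j
    using c[of i j] that by auto
  ultimately show ?thesis using that R by blast
qed

text \<open>Serves the case \<open>r * s * t \<ge> 0\<close>. The quantity
  \<open>R * (a * R - S * T)\<close> is either nonpositive or at most its value at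
  \<open>R = b\<close>.\<close>

lemma reduced_disc_bound_aux1:
  fixes a b R S T :: int
  assumes "0 \<le> R" "R \<le> b" "0 \<le> S" "S \<le> a" "0 \<le> T" "T \<le> a" "a \<le> b"
  shows "a * R\<^sup>2 + b * S\<^sup>2 + b * T\<^sup>2 - R * S * T \<le> 2 * a * b\<^sup>2"
proof -
  have ST: "S\<^sup>2 \<le> a * b" "T\<^sup>2 \<le> a * b" unfolding power2_eq_square using assms by (auto intro!: mult_mono)
  have b0: "b \<ge> 0" "a \<ge> 0" using assms by auto
  show ?thesis
  proof (cases "S * T \<ge> a * R")
    case True
    have "R * (S * T - a * R) \<ge> 0" using True assms by simp
    moreover have "b * S\<^sup>2 \<le> b * (a * b)" "b * T\<^sup>2 \<le> b * (a * b)" using ST b0 by (auto intro: mult_left_mono)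
    ultimately show ?thesis by (simp add: algebra_simps power2_eq_square)
  next
    case False
    have "R * (a * R - S * T) \<le> b * (a * R - S * T)" using False assms by (intro mult_right_mono) auto
    also have "\<dots> \<le> b * (a * b - S * T)" using assms b0 by (intro mult_left_mono diff_mono) auto
    finally have 1: "R * (a * R - S * T) \<le> b * (a * b - S * T)" .
    have "S\<^sup>2 + T\<^sup>2 - S * T \<le> a * b"
    proof (cases "S \<le> T")
      case True
      have "S * S \<le> S * T" using True assms by (intro mult_left_mono) auto
      thus ?thesis using ST by (simp add: power2_eq_square)
    next
      case False
      have "T * T \<le> S * T" using False assms by (intro mult_right_mono) auto
      thus ?thesis using ST by (simp add: power2_eq_square)
    qed
    hence "b * (S\<^sup>2 + T\<^sup>2 - S * T) \<le> b * (a * b)" using b0 by (intro mult_left_mono) auto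
    thus ?thesis using 1 by (simp add: algebra_simps power2_eq_square)
  qed
qed

text \<open>Serves the case \<open>r * s * t < 0\<close>, where separate bounds do not suffice:
  \<open>R = S = T = a = b\<close> would violate the claim. The excess \<delta> of
  \<open>S + T\<close> over \<open>a\<close> forces \<open>R \<le> b - \<delta>\<close>, and
  \<open>a * \<delta> \<le> S * T\<close> because \<open>(a - S) * (a - T) \<ge> 0\<close>.\<close>

lemma reduced_disc_bound_aux2:
  fixes a b R S T :: int
  assumes "0 \<le> R" "R \<le> b" "0 \<le> S" "S \<le> a" "0 \<le> T" "T \<le> a" "a \<le> b" "R + S + T \<le> a + b"
  shows "a * R\<^sup>2 + b * S\<^sup>2 + b * T\<^sup>2 + R * S * T \<le> 2 * a * b\<^sup>2"
proof -
  have b0: "b \<ge> 0" "a \<ge> 0" using assms by auto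
  have ab: "a * a * b \<le> a * b * b" using assms b0 by (simp add: mult_left_mono mult_right_mono)
  show ?thesis
  proof (cases "S + T \<le> a")
    case True
    have "R * (S * T) \<le> 2 * b * (S * T)" using assms b0 by (intro mult_right_mono) auto
    moreover have "b * ((S + T) * (S + T)) \<le> b * (a * a)"
      using True assms b0 by (intro mult_left_mono mult_mono) auto
    moreover have "a * (R * R) \<le> a * (b * b)" using assms b0 by (intro mult_left_mono mult_mono) auto
    ultimately show ?thesis using ab by (simp add: algebra_simps power2_eq_square)
  next
    case False
    define \<delta> where "\<delta> = S + T - a"
    have \<delta>: "0 \<le> \<delta>" "\<delta> \<le> a" "\<delta> \<le> b - R" using False assms by (auto simp: \<delta>_def)
    have "(2 * b - R) * (a * \<delta>) \<le> (2 * b - R) * (S * T)"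
    proof (rule mult_left_mono)
      have "(a - S) * (a - T) \<ge> 0" using assms by simp
      thus "a * \<delta> \<le> S * T" by (simp add: \<delta>_def algebra_simps)
    qed (use assms b0 in simp)
    moreover have "b * (\<delta> * \<delta>) \<le> b * (a * \<delta>)" using \<delta> b0 by (intro mult_left_mono mult_right_mono) auto
    moreover have "a * (\<delta> * (b + R)) \<le> a * ((b - R) * (b + R))"
      using \<delta> b0 assms by (intro mult_left_mono mult_right_mono) auto
    moreover have "b * S\<^sup>2 + b * T\<^sup>2 = b * ((a + \<delta>) * (a + \<delta>)) - 2 * b * (S * T)"
      by (simp add: \<delta>_def algebra_simps power2_eq_square)
    ultimately show ?thesis using ab by (simp add: algebra_simps power2_eq_square)
  qed
qed

text \<open>The inequality of Gauss and Seeber. The difference of the two sides is affine in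
  \<open>c\<close> with slope \<open>2 * a * b - t\<^sup>2 \<ge> 0\<close>, so \<open>c\<close> may
  be replaced by \<open>b\<close>; the sign of \<open>r * s * t\<close> selects the auxiliary
  estimate.\<close>

lemma reduced_disc_bound:
  assumes "0 < a" "a \<le> b" "b \<le> c" "\<bar>t\<bar> \<le> a" "\<bar>s\<bar> \<le> a" "\<bar>r\<bar> \<le> b"
    and tri: "\<And>i j. i \<in> {-1, 1} \<Longrightarrow> j \<in> {-1, 1} \<Longrightarrow> a + b + i * s + j * r + i * j * t \<ge> 0"
  shows "2 * a * b * c \<le> ternary_disc a b c r s t"
proof -
  have "\<bar>t\<bar> * \<bar>t\<bar> \<le> a * b" using assms by (intro mult_mono) auto
  moreover have "0 \<le> a * b" using assms by simp
  ultimately have "t\<^sup>2 \<le> 2 * a * b" by (simp add: power2_eq_square)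
  hence "b * (2 * a * b - t\<^sup>2) \<le> c * (2 * a * b - t\<^sup>2)" using assms by (intro mult_right_mono) auto
  moreover have "a * r\<^sup>2 + b * s\<^sup>2 + b * t\<^sup>2 - r * s * t \<le> 2 * a * b\<^sup>2"
  proof (cases "r * s * t \<ge> 0")
    case True
    hence "r * s * t = \<bar>r\<bar> * \<bar>s\<bar> * \<bar>t\<bar>" by (simp add: abs_mult[symmetric])
    thus ?thesis using reduced_disc_bound_aux1[of "\<bar>r\<bar>" b "\<bar>s\<bar>" a "\<bar>t\<bar>"] assms by simp
  next
    case False
    hence eq: "r * s * t = - (\<bar>r\<bar> * \<bar>s\<bar> * \<bar>t\<bar>)" by (simp add: abs_mult[symmetric])
    define i j where "i = - sgn s" and "j = - sgn r"
    have nz: "r \<noteq> 0" "s \<noteq> 0" "t \<noteq> 0" using False by auto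
    hence ij: "i \<in> {-1, 1}" "j \<in> {-1, 1}" by (auto simp: i_def j_def sgn_if)
    have "i * s = - \<bar>s\<bar>" "j * r = - \<bar>r\<bar>" by (simp_all add: i_def j_def abs_sgn mult.commute)
    moreover have "i * j * t = - \<bar>t\<bar>"
    proof -
      have "sgn (r * s * t) = -1" using False by simp
      hence "sgn r * sgn s * sgn t = -1" by (simp add: sgn_mult)
      hence "sgn r * sgn s = - sgn t" using nz by (auto simp: sgn_if split: if_splits)
      thus ?thesis by (simp add: i_def j_def abs_sgn mult.commute)
    qed
    ultimately have "\<bar>r\<bar> + \<bar>s\<bar> + \<bar>t\<bar> \<le> a + b" using tri[OF ij] by simp
    thus ?thesis using reduced_disc_bound_aux2[of "\<bar>r\<bar>" b "\<bar>s\<bar>" a "\<bar>t\<bar>"] assms eq by simp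
  qed
  ultimately show ?thesis by (simp add: ternary_disc_def algebra_simps power2_eq_square)
qed

text \<open>Here \<open>b * b \<le> a * b * c \<le> 3\<close> forces \<open>a = b = 1\<close>. The
  bound \<open>D = 8\<close> would already admit \<open>b = c = 2\<close>.\<close>

lemma reduced_small_disc:
  assumes "represented D n a b c r s t" "D < 8"
  obtains c r s t where "represented D n 1 1 c r s t" "c \<in> {1, 2, 3}" "r \<in> {-1, 0, 1}" "s \<in> {-1, 0, 1}" "t \<in> {-1, 0, 1}"
proof -
  obtain a b c r s t where R: "represented D n a b c r s t" "a \<le> b" "b \<le> c" "\<bar>t\<bar> \<le> a" "\<bar>s\<bar> \<le> a" "\<bar>r\<bar> \<le> b"
    "\<And>i j. i \<in> {-1, 1} \<Longrightarrow> j \<in> {-1, 1} \<Longrightarrow> a + b + i * s + j * r + i * j * t \<ge> 0"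
    using exists_reduced[OF assms(1)] by metis
  have pos: "a > 0" "b > 0" "c > 0" using represented_pos[OF R(1)] .
  have "2 * a * b * c \<le> ternary_disc a b c r s t" by (rule reduced_disc_bound[OF pos(1) R(2-7)])
  hence abc: "a * b * c \<le> 3" using R(1) assms(2) by (simp add: represented_def)
  have "b * b \<le> b * c" using R(3) pos by (intro mult_left_mono) auto
  also have "\<dots> \<le> a * (b * c)" using pos by simp
  finally have bb: "b * b \<le> 3" using abc by (simp add: mult.assoc)
  have b1: "b = 1"
  proof (rule ccontr)
    assume "b \<noteq> 1"
    hence "2 * 2 \<le> b * b" using pos by (intro mult_mono) auto
    thus False using bb by simp
  qed
  have a1: "a = 1" using R(2) pos b1 by simp
  have "represented D n 1 1 c r s t" using R(1) by (simp only: a1 b1)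
  moreover have "c \<in> {1, 2, 3}" using abc pos(3) unfolding a1 b1 by auto
  moreover have "r \<in> {-1, 0, 1}" "s \<in> {-1, 0, 1}" "t \<in> {-1, 0, 1}" using R(4-6) unfolding a1 b1 by auto
  ultimately show ?thesis by (rule that)
qed

lemma represented_disc_7:
  assumes "represented 7 n a b c r s t"
  shows "\<exists>x y z. n = x\<^sup>2 + x * z + 2 * z\<^sup>2 + y\<^sup>2"
proof -
  have "(7::int) < 8" by simp
  from assms this obtain c r s t where R: "represented 7 n 1 1 c r s t" "c \<in> {1, 2, 3}" "r \<in> {-1, 0, 1}" "s \<in> {-1, 0, 1}" "t \<in> {-1, 0, 1}"
    by (rule reduced_small_disc)
  have "ternary_disc 1 1 c r s t = 7" using R(1) by (simp add: represented_def)
  hence "c = 2 \<and> t = 0 \<and> (r = 0 \<and> s \<in> {-1, 1} \<or> s = 0 \<and> r \<in> {-1, 1})"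
    using R(2-5) by (auto simp: ternary_disc_def)
  moreover obtain x y z where "n = ternary_form 1 1 c r s t x y z" using R(1) unfolding represented_def by blast
  ultimately have "n = x\<^sup>2 + x * z + 2 * z\<^sup>2 + y\<^sup>2 \<or> n = x\<^sup>2 + x * (-z) + 2 * (-z)\<^sup>2 + y\<^sup>2 \<or>
      n = y\<^sup>2 + y * z + 2 * z\<^sup>2 + x\<^sup>2 \<or> n = y\<^sup>2 + y * (-z) + 2 * (-z)\<^sup>2 + x\<^sup>2"
    by (auto simp: ternary_form_def)
  thus ?thesis by blast
qed

lemma represented_disc_5:
  assumes "represented 5 n a b c r s t"
  shows "\<exists>x y z. n = x\<^sup>2 + y\<^sup>2 + 2 * z\<^sup>2 + x * y + x * z + y * z"
proof -
  define F where "F x y z = x\<^sup>2 + y\<^sup>2 + 2 * z\<^sup>2 + x * y + x * z + y * z" for x y z :: int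
  have "(5::int) < 8" by simp
  from assms this obtain c r s t where R: "represented 5 n 1 1 c r s t" "c \<in> {1, 2, 3}" "r \<in> {-1, 0, 1}" "s \<in> {-1, 0, 1}" "t \<in> {-1, 0, 1}"
    by (rule reduced_small_disc)
  have "ternary_disc 1 1 c r s t = 5" using R(1) by (simp add: represented_def)
  hence d: "c = 2 \<and> t \<in> {-1, 1} \<and> (r \<in> {-1, 1} \<and> s = r * t \<or> s = 0 \<and> r \<in> {-1, 1} \<or> r = 0 \<and> s \<in> {-1, 1})"
    using R(2-5) by (auto simp: ternary_disc_def)
  obtain x y z where n: "n = ternary_form 1 1 c r s t x y z" using R(1) unfolding represented_def by blast
  \<comment> \<open>Up to signs, the six cases differ by automorphisms of
    \<open>x\<^sup>2 + x * y + y\<^sup>2\<close>.\<close>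
  have "n = F x y (r * z)" if "t = 1" "r \<in> {-1, 1}" "s = r"
    using that d n by (auto simp: ternary_form_def F_def)
  moreover have "n = F (-x) y (r * z)" if "t = -1" "r \<in> {-1, 1}" "s = -r"
    using that d n by (auto simp: ternary_form_def F_def)
  moreover have "n = F (-x - y) x (- r * z)" if "t = 1" "r \<in> {-1, 1}" "s = 0"
    using that d n by (auto simp: ternary_form_def F_def algebra_simps power2_eq_square)
  moreover have "n = F (x - y) (-x) (- r * z)" if "t = -1" "r \<in> {-1, 1}" "s = 0"
    using that d n by (auto simp: ternary_form_def F_def algebra_simps power2_eq_square)
  moreover have "n = F (-x - y) y (- s * z)" if "t = 1" "s \<in> {-1, 1}" "r = 0"
    using that d n by (auto simp: ternary_form_def F_def algebra_simps power2_eq_square)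
  moreover have "n = F (y - x) (-y) (- s * z)" if "t = -1" "s \<in> {-1, 1}" "r = 0"
    using that d n by (auto simp: ternary_form_def F_def algebra_simps power2_eq_square)
  ultimately have "n = F x y (r * z) \<or> n = F (-x) y (r * z) \<or> n = F (-x - y) x (- r * z) \<or>
      n = F (x - y) (-x) (- r * z) \<or> n = F (-x - y) y (- s * z) \<or> n = F (y - x) (-y) (- s * z)"
    using d by auto
  hence "\<exists>x y z. n = F x y z" by blast
  thus ?thesis unfolding F_def .
qed

text \<open>The form below is half the norm on the lattice spanned by \<open>f\<^sub>1\<close>, \<open>f\<^sub>2\<close> with Gram matrix \<open>2 * (m, X; X, l)\<close> and
  by \<open>(v + \<tau> * (m * f\<^sub>2 - X * f\<^sub>1)) / (2 * K)\<close>, where \<open>v\<close> is orthogonal to \<open>f\<^sub>1\<close>, \<open>f\<^sub>2\<close> and has norm \<open>2 * q * K\<close>.\<close>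

lemma exists_representing_form:
  assumes K: "K > (0::nat)" and q: "prime q" "q > 2" "\<not> q dvd K" "Legendre (- int K) (int q) = -1"
  shows "\<exists>a b c r s t. represented (int q) (int q * int K) a b c r s t"
proof -
  obtain m \<tau> X where m: "m > 0" "4 * int K dvd m * \<tau>\<^sup>2 + int q" "m dvd X\<^sup>2 + int K"
    using exists_multiplier[OF assms] .
  \<comment> \<open>The two divisibilities provided by the multiplier say that the coefficients
    \<open>c\<close> and \<open>l\<close> of the glued form are integers.\<close>
  obtain c where c: "m * \<tau>\<^sup>2 + int q = 4 * int K * c" using m(2) by blast
  obtain l where l: "X\<^sup>2 + int K = m * l" using m(3) by blast
  define F where "F = ternary_form m l c \<tau> 0 (2 * X)"
  have id: "4 * int K * (m * F x y z) = 4 * int K * (m * x + X * y)\<^sup>2 +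
      (2 * int K * y + m * \<tau> * z)\<^sup>2 + m * int q * z\<^sup>2" for x y z
  proof -
    have "m * F x y z = (m * x + X * y)\<^sup>2 + (m * l - X\<^sup>2) * y\<^sup>2 + m * \<tau> * y * z + m * c * z\<^sup>2"
      by (simp add: F_def ternary_form_def algebra_simps power2_eq_square)
    also have "m * l - X\<^sup>2 = int K" using l by simp
    finally have "4 * int K * (m * F x y z) = 4 * int K * (m * x + X * y)\<^sup>2 +
        4 * int K * int K * y\<^sup>2 + 4 * int K * m * \<tau> * y * z + (4 * int K * c) * m * z\<^sup>2"
      by (simp add: algebra_simps)
    also have "4 * int K * c = m * \<tau>\<^sup>2 + int q" using c by simp
    finally show ?thesis by (simp add: algebra_simps power2_eq_square)
  qed
  have pos: "F x y z > 0" if xyz: "(x, y, z) \<noteq> (0, 0, 0)" for x y z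
  proof -
    have "4 * int K * (m * x + X * y)\<^sup>2 + (2 * int K * y + m * \<tau> * z)\<^sup>2 + m * int q * z\<^sup>2 > 0"
    proof (cases "z = 0")
      case False
      have "m * int q * z\<^sup>2 > 0" using m(1) q(2) False by simp
      thus ?thesis by (smt (verit) mult_nonneg_nonneg of_nat_0_le_iff zero_le_power2)
    next
      case z: True
      show ?thesis
      proof (cases "y = 0")
        case True
        hence "x \<noteq> 0" using xyz z by simp
        thus ?thesis using True z K m(1) by simp
      next
        case False
        hence "(2 * int K * y)\<^sup>2 > 0" using K by simp
        moreover have "4 * int K * (m * x + X * y)\<^sup>2 \<ge> 0" by simp
        ultimately have "4 * int K * (m * x + X * y)\<^sup>2 + (2 * int K * y)\<^sup>2 > 0" by linarith
        thus ?thesis using z by simp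
      qed
    qed
    hence "4 * int K * (m * F x y z) > 0" using id by metis
    thus ?thesis using K m(1) by (simp add: zero_less_mult_iff)
  qed
  have "ternary_disc m l c \<tau> 0 (2 * X) = (4 * c) * (m * l - X\<^sup>2) - m * \<tau>\<^sup>2"
    by (simp add: ternary_disc_def algebra_simps power2_eq_square)
  also have "m * l - X\<^sup>2 = int K" using l by simp
  also have "4 * c * int K = m * \<tau>\<^sup>2 + int q" using c by (simp add: mult_ac)
  finally have disc: "ternary_disc m l c \<tau> 0 (2 * X) = int q" by simp
  \<comment> \<open>These are the coordinates of \<open>v\<close>; the first two squares in
    \<open>id\<close> vanish there.\<close>
  have "4 * int K * (m * F (\<tau> * X) (- \<tau> * m) (2 * int K)) = 4 * int K * (m * (int q * int K))"
    unfolding id by (simp add: algebra_simps power2_eq_square)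
  hence "F (\<tau> * X) (- \<tau> * m) (2 * int K) = int q * int K" using K m(1) by simp
  thus ?thesis unfolding represented_def using disc pos unfolding F_def by blast
qed

section \<open>Two diagonal quaternary forms with prescribed linear sum\<close>

lemma square_mod_5: "(y::int)\<^sup>2 mod 5 \<in> {0, 1, 4}"
proof -
  have "y mod 5 \<in> {0, 1, 2, 3, 4}" using pos_mod_bound[of 5 y] pos_mod_sign[of 5 y] by force
  moreover have "y\<^sup>2 mod 5 = (y mod 5)\<^sup>2 mod 5" by (simp add: power_mod)
  ultimately show ?thesis by auto
qed

lemma square_mod_7: "(y::int)\<^sup>2 mod 7 \<in> {0, 1, 2, 4}"
proof -
  have "y mod 7 \<in> {0, 1, 2, 3, 4, 5, 6}" using pos_mod_bound[of 7 y] pos_mod_sign[of 7 y] by force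
  moreover have "y\<^sup>2 mod 7 = (y mod 7)\<^sup>2 mod 7" by (simp add: power_mod)
  ultimately show ?thesis by auto
qed

lemma dvd_square_iff_7: "7 dvd (y::int)\<^sup>2 \<longleftrightarrow> 7 dvd y"
  by (simp add: prime_dvd_power_iff)

lemma dvd_square_iff_5: "5 dvd (y::int)\<^sup>2 \<longleftrightarrow> 5 dvd y"
  by (simp add: prime_dvd_power_iff)

text \<open>\<open>-1\<close> is not a square modulo 7. Up to its radical, the form of discriminant
  7 is this binary form modulo 7, so values divisible by 7 occur only on a sublattice. The next
  lemma does the same at 5, where \<open>-3\<close> is not a square.\<close>

lemma square_plus_square_dvd_7:
  assumes "7 dvd (u::int)\<^sup>2 + v\<^sup>2"
  shows "7 dvd u" "7 dvd v"
proof -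
  obtain i j where ij: "u\<^sup>2 mod 7 = i" "v\<^sup>2 mod 7 = j" by blast
  have "(i + j) mod 7 = 0" using assms ij by (metis dvd_eq_mod_eq_0 mod_add_eq)
  moreover have "i \<in> {0, 1, 2, 4}" "j \<in> {0, 1, 2, 4}" using square_mod_7 ij by blast+
  ultimately have "i = 0" "j = 0" by auto
  thus "7 dvd u" "7 dvd v" using ij dvd_square_iff_7 by (metis dvd_eq_mod_eq_0)+
qed

lemma three_square_plus_square_dvd_5:
  assumes "5 dvd 3 * (u::int)\<^sup>2 + v\<^sup>2"
  shows "5 dvd u" "5 dvd v"
proof -
  obtain i j where ij: "u\<^sup>2 mod 5 = i" "v\<^sup>2 mod 5 = j" by blast
  have "(3 * i + j) mod 5 = (3 * u\<^sup>2 + v\<^sup>2) mod 5" unfolding ij[symmetric] by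
    (metis mod_add_left_eq mod_add_right_eq mod_mult_right_eq)
  hence "(3 * i + j) mod 5 = 0" using assms by simp
  moreover have "i \<in> {0, 1, 4}" "j \<in> {0, 1, 4}" using square_mod_5 ij by blast+
  ultimately have "i = 0" "j = 0" by auto
  thus "5 dvd u" "5 dvd v" using ij dvd_square_iff_5 by (metis dvd_eq_mod_eq_0)+
qed

lemma Legendre_nonresidueI:
  assumes "\<not> p dvd a" "\<And>y. \<not> p dvd y\<^sup>2 - a"
  shows "Legendre a p = -1"
  using assms unfolding Legendre_def QuadRes_def by (auto simp: cong_iff_dvd_diff)

text \<open>\<open>-1\<close> is a nonresidue modulo 7, so the classes 1, 2, 4 of \<open>K\<close>
  are those making \<open>- K\<close> a nonresidue. Modulo 5, where \<open>-1\<close> is a square,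
  the corresponding classes are 2 and 3.\<close>

lemma represented_by_disc_7:
  fixes K :: int
  assumes "K > 0" "K mod 7 \<in> {1, 2, 4}"
  shows "\<exists>x y z. 7 * K = x\<^sup>2 + x * z + 2 * z\<^sup>2 + y\<^sup>2"
proof -
  have nd: "\<not> 7 dvd y\<^sup>2 + K" for y
  proof
    assume *: "7 dvd y\<^sup>2 + K"
    obtain i where i: "y\<^sup>2 mod 7 = i" by blast
    have "(i + K mod 7) mod 7 = 0" using * unfolding i[symmetric] by (simp add: mod_simps dvd_eq_mod_eq_0)
    moreover have "i \<in> {0, 1, 2, 4}" using square_mod_7 i by blast
    ultimately show False using assms(2) by auto
  qed
  have "\<not> 7 dvd K" using assms(2) by auto
  hence "Legendre (- K) 7 = -1" using nd by (intro Legendre_nonresidueI) auto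
  moreover have "\<not> 7 dvd nat K" using \<open>\<not> 7 dvd K\<close> assms(1) by (metis int_dvd_int_iff int_nat_eq less_imp_le of_nat_numeral)
  moreover have "prime (7::nat)" by simp
  ultimately have "\<exists>a b c r s t. represented 7 (7 * K) a b c r s t"
    using exists_representing_form[of "nat K" 7] assms(1) by simp
  thus ?thesis using represented_disc_7 by blast
qed

lemma represented_by_disc_5:
  fixes K :: int
  assumes "K > 0" "K mod 5 \<in> {2, 3}"
  shows "\<exists>x y z. 5 * K = x\<^sup>2 + y\<^sup>2 + 2 * z\<^sup>2 + x * y + x * z + y * z"
proof -
  have nd: "\<not> 5 dvd y\<^sup>2 + K" for y
  proof
    assume *: "5 dvd y\<^sup>2 + K"
    obtain i where i: "y\<^sup>2 mod 5 = i" by blast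
    have "(i + K mod 5) mod 5 = 0" using * unfolding i[symmetric] by (simp add: mod_simps dvd_eq_mod_eq_0)
    moreover have "i \<in> {0, 1, 4}" using square_mod_5 i by blast
    ultimately show False using assms(2) by auto
  qed
  have "\<not> 5 dvd K" using assms(2) by auto
  hence "Legendre (- K) 5 = -1" using nd by (intro Legendre_nonresidueI) auto
  moreover have "\<not> 5 dvd nat K" using \<open>\<not> 5 dvd K\<close> assms(1) by (metis int_dvd_int_iff int_nat_eq less_imp_le of_nat_numeral)
  moreover have "prime (5::nat)" by simp
  ultimately have "\<exists>a b c r s t. represented 5 (5 * K) a b c r s t"
    using exists_representing_form[of "nat K" 5] assms(1) by simp
  thus ?thesis using represented_disc_5 by blast
qed

text \<open>Modulo 3 the form is \<open>e * (e + g) - (g - h) * (g + h)\<close>, and these two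
  products agree modulo 3 only if both vanish.\<close>

lemma form_mod_3_isotropic:
  fixes g e h :: int
  assumes "3 dvd 2 * g\<^sup>2 + g * e + e\<^sup>2 + 7 * h\<^sup>2"
  shows "(3 dvd e \<or> 3 dvd e + g) \<and> (3 dvd g - h \<or> 3 dvd g + h)"
proof -
  obtain i j l where ijl: "g mod 3 = i" "e mod 3 = j" "h mod 3 = l" by blast
  have range: "i \<in> {0, 1, 2}" "j \<in> {0, 1, 2}" "l \<in> {0, 1, 2}"
    unfolding ijl[symmetric] using pos_mod_bound[of 3] pos_mod_sign[of 3] by (smt (verit) insertCI)+
  have c: "[g = i] (mod 3)" "[e = j] (mod 3)" "[h = l] (mod 3)"
    unfolding ijl[symmetric] by (simp_all add: cong_def)
  have "[2 * g\<^sup>2 + g * e + e\<^sup>2 + 7 * h\<^sup>2 = 2 * i\<^sup>2 + i * j + j\<^sup>2 + 7 * l\<^sup>2] (mod 3)"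
    by (intro cong_add cong_mult cong_pow c cong_refl)
  hence "3 dvd 2 * i\<^sup>2 + i * j + j\<^sup>2 + 7 * l\<^sup>2" using assms cong_dvd_iff by blast
  hence "(3 dvd j \<or> 3 dvd j + i) \<and> (3 dvd i - l \<or> 3 dvd i + l)"
    using range by auto
  moreover have "3 dvd e \<longleftrightarrow> 3 dvd j" "3 dvd e + g \<longleftrightarrow> 3 dvd j + i" "3 dvd g - h \<longleftrightarrow> 3 dvd i - l" "3 dvd g + h \<longleftrightarrow> 3 dvd i + l"
    by (intro cong_dvd_iff cong_add cong_diff c)+
  ultimately show ?thesis by blast
qed

text \<open>The vectors of \<open>2 * g\<^sup>2 + g * e + e\<^sup>2 + 7 * h\<^sup>2\<close> that are isotropic modulo 3 lie on four lines modulo 3, which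
  the automorphisms \<open>h \<mapsto> -h\<close> and \<open>(g, e) \<mapsto> (-g, e + g)\<close> permute transitively.\<close>

lemma represented_disc_147:
  fixes k :: int
  assumes "k > 0" "k mod 7 \<in> {3, 5, 6}"
  shows "\<exists>p q r. k = 3 * p\<^sup>2 + 3 * q\<^sup>2 + 5 * r\<^sup>2 - p * q - 2 * p * r - 2 * q * r"
proof -
  \<comment> \<open>3 is a nonresidue modulo 7, so \<open>3 * k\<close> falls into the classes
    covered by \<open>represented_by_disc_7\<close>; the factor 3 is removed at the end on a
    sublattice where the form is divisible by 3.\<close>
  have "(3 * k) mod 7 = (3 * (k mod 7)) mod 7" by (simp add: mod_simps)
  hence "(3 * k) mod 7 \<in> {1, 2, 4}" using assms(2) by auto
  then obtain x y z where xyz: "7 * (3 * k) = x\<^sup>2 + x * z + 2 * z\<^sup>2 + y\<^sup>2"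
    using represented_by_disc_7[of "3 * k"] assms(1) by auto
  have "(2 * x + z)\<^sup>2 + (2 * y)\<^sup>2 = 7 * (12 * k - z\<^sup>2)"
    using xyz by (simp add: algebra_simps power2_eq_square)
  hence "7 dvd (2 * x + z)\<^sup>2 + (2 * y)\<^sup>2" by simp
  from square_plus_square_dvd_7[OF this] obtain g where g: "2 * x + z = 7 * g" and "7 dvd 2 * y" by blast
  hence "7 dvd y" using prime_dvd_mult_iff[of "7::int" 2 y] by simp
  then obtain h where h: "y = 7 * h" by blast
  define e where "e = 3 * g - x"
  have x: "x = 3 * g - e" and z: "z = g + 2 * e" using g by (simp_all add: e_def)
  have "7 * (3 * k) = 7 * (2 * g\<^sup>2 + g * e + e\<^sup>2 + 7 * h\<^sup>2)"
    unfolding xyz x z h by (simp add: algebra_simps power2_eq_square)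
  hence eq: "3 * k = 2 * g\<^sup>2 + g * e + e\<^sup>2 + 7 * h\<^sup>2" by simp
  have "3 dvd 2 * g\<^sup>2 + g * e + e\<^sup>2 + 7 * h\<^sup>2" unfolding eq[symmetric] by simp
  note mod3 = form_mod_3_isotropic[OF this]
  have "\<exists>g e. 3 * k = 2 * g\<^sup>2 + g * e + e\<^sup>2 + 7 * h\<^sup>2 \<and> 3 dvd e \<and> (3 dvd g - h \<or> 3 dvd g + h)"
  proof (cases "3 dvd e")
    case True thus ?thesis using eq mod3 by blast
  next
    case False
    have "3 * k = 2 * (-g)\<^sup>2 + (-g) * (e + g) + (e + g)\<^sup>2 + 7 * h\<^sup>2"
      using eq by (simp add: algebra_simps power2_eq_square)
    moreover have "3 dvd - g - h \<or> 3 dvd - g + h" using mod3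
      by (metis add.commute add_uminus_conv_diff dvd_minus_iff minus_add_distrib minus_diff_eq minus_minus)
    ultimately show ?thesis using False mod3 by blast
  qed
  then obtain g e where ge: "3 * k = 2 * g\<^sup>2 + g * e + e\<^sup>2 + 7 * h\<^sup>2" "3 dvd e" "3 dvd g - h \<or> 3 dvd g + h" by blast
  then obtain h' where h': "3 * k = 2 * g\<^sup>2 + g * e + e\<^sup>2 + 7 * h'\<^sup>2" "3 dvd g - h'"
  proof (cases "3 dvd g - h")
    case False
    hence "3 dvd g - (- h)" using ge(3) by simp
    thus ?thesis using ge(1) that[of "-h"] by simp
  qed blast
  obtain q' r where "e = 3 * q'" "g - h' = 3 * r" using ge(2) h'(2) by blast
  hence "e = 3 * q'" "g = h' + 3 * r" by simp_all
  hence "3 * k = 3 * (3 * (h' + r)\<^sup>2 + 3 * (-q')\<^sup>2 + 5 * r\<^sup>2 - (h' + r) * (-q') - 2 * (h' + r) * r - 2 * (-q') * r)"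
    using h'(1) by (simp add: algebra_simps power2_eq_square)
  thus ?thesis by (intro exI[of _ "h' + r"] exI[of _ "-q'"] exI[of _ r]) simp
qed

text \<open>With \<open>w = z + p\<close>, \<open>x = z + q\<close>, \<open>y = z + r\<close> and
  \<open>s = p + q + 2 * r\<close>, the sum is \<open>b = 7 * z + s\<close>, and
  \<open>7 * a - b\<^sup>2\<close> is a form in \<open>p\<close>, \<open>q\<close>, \<open>r\<close>
  alone, twice that of \<open>represented_disc_147\<close>. Any representation satisfies
  \<open>b\<^sup>2 = s\<^sup>2\<close> modulo 7, so after a change of sign \<open>z\<close> is
  integral.\<close>

lemma quaternary_with_sum_1:
  fixes a b :: int
  assumes "even (a - b)" "\<not> 7 dvd b" "b\<^sup>2 < 7 * a"
  shows "\<exists>w x y z. w\<^sup>2 + x\<^sup>2 + 2 * y\<^sup>2 + 3 * z\<^sup>2 = a \<and> w + x + 2 * y + 3 * z = b"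
proof -
  have "even (7 * a - b\<^sup>2)" using assms(1) by simp
  then obtain k where k: "7 * a - b\<^sup>2 = 2 * k" by blast
  have k0: "k > 0" using k assms(3) by simp
  obtain i j where ij: "b\<^sup>2 mod 7 = i" "k mod 7 = j" by blast
  have "(i + 2 * j) mod 7 = (b\<^sup>2 + 2 * k) mod 7" unfolding ij[symmetric] by
    (metis mod_add_left_eq mod_add_right_eq mod_mult_right_eq)
  also have "b\<^sup>2 + 2 * k = 7 * a" using k by simp
  finally have "(i + 2 * j) mod 7 = 0" by simp
  moreover have "i \<in> {1, 2, 4}"
    using square_mod_7[of b] ij assms(2) dvd_square_iff_7[of b] by (auto simp: dvd_eq_mod_eq_0)
  moreover have "j \<in> {0, 1, 2, 3, 4, 5, 6}"
    unfolding ij[symmetric] using pos_mod_bound[of 7 k] pos_mod_sign[of 7 k] by force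
  ultimately have "k mod 7 \<in> {3, 5, 6}" using ij by auto
  then obtain p q r where k2: "k = 3 * p\<^sup>2 + 3 * q\<^sup>2 + 5 * r\<^sup>2 - p * q - 2 * p * r - 2 * q * r"
    using represented_disc_147[OF k0] by blast
  define Q where "Q p q r = 7 * (p\<^sup>2 + q\<^sup>2 + 2 * r\<^sup>2) - (p + q + 2 * r)\<^sup>2" for p q r :: int
  have Q: "Q p q r = 7 * a - b\<^sup>2" unfolding k k2 Q_def by (simp add: algebra_simps power2_eq_square)
  have "\<exists>p q r. Q p q r = 7 * a - b\<^sup>2 \<and> 7 dvd b - (p + q + 2 * r)"
  proof -
    define s where "s = p + q + 2 * r"
    have "(b - s) * (b + s) = 7 * (a - (p\<^sup>2 + q\<^sup>2 + 2 * r\<^sup>2))"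
      using Q by (simp add: Q_def s_def algebra_simps power2_eq_square)
    hence "7 dvd (b - s) * (b + s)" by simp
    hence "7 dvd b - s \<or> 7 dvd b + s" using prime_dvd_mult_iff[of "7::int"] by simp
    thus ?thesis
    proof
      assume "7 dvd b - s" thus ?thesis using Q s_def by blast
    next
      assume "7 dvd b + s"
      hence "7 dvd b - (- p + - q + 2 * (- r))" by (simp add: s_def algebra_simps)
      moreover have "Q (-p) (-q) (-r) = Q p q r" by (simp add: Q_def algebra_simps power2_eq_square)
      ultimately show ?thesis using Q by metis
    qed
  qed
  then obtain p q r z where z: "Q p q r = 7 * a - b\<^sup>2" "b - (p + q + 2 * r) = 7 * z" by blast
  have b: "b = 7 * z + p + q + 2 * r" using z(2) by simp
  have "7 * ((z + p)\<^sup>2 + (z + q)\<^sup>2 + 2 * (z + r)\<^sup>2 + 3 * z\<^sup>2) = 7 * a"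
    using z(1) unfolding Q_def b by (simp add: algebra_simps power2_eq_square)
  hence "(z + p)\<^sup>2 + (z + q)\<^sup>2 + 2 * (z + r)\<^sup>2 + 3 * z\<^sup>2 = a" by simp
  moreover have "(z + p) + (z + q) + 2 * (z + r) + 3 * z = b" using b by simp
  ultimately show ?thesis by blast
qed

text \<open>Putting \<open>w = - (x + y + z)\<close> makes twice the form of discriminant 5
  symmetric in \<open>x\<close>, \<open>y\<close>, \<open>w\<close>. These three are congruent
  modulo 5 by anisotropy, and two of them agree modulo 2, so they can be permuted to have
  \<open>x - w\<close> divisible by 10. In terms of the solution, \<open>u\<close> is half the
  difference of the first two variables, \<open>v\<close> is half their sum minus \<open>y\<close>,
  and \<open>t'\<close> is \<open>b - 5 * z\<close>.\<close>

lemma quaternary_with_sum_2: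
  fixes a b K :: int
  assumes K: "5 * a - b\<^sup>2 = 3 * K" "K > 0" and b: "\<not> 5 dvd b"
  shows "\<exists>w x y z. w\<^sup>2 + x\<^sup>2 + 2 * y\<^sup>2 + 6 * z\<^sup>2 = 2 * a \<and> w + x + 2 * y + 6 * z = 2 * b"
proof -
  obtain i j where ij: "b\<^sup>2 mod 5 = i" "K mod 5 = j" by blast
  have "(i + 3 * j) mod 5 = (b\<^sup>2 + 3 * K) mod 5" unfolding ij[symmetric] by
    (metis mod_add_left_eq mod_add_right_eq mod_mult_right_eq)
  also have "b\<^sup>2 + 3 * K = 5 * a" using K by simp
  finally have "(i + 3 * j) mod 5 = 0" by simp
  moreover have "i \<in> {1, 4}"
    using square_mod_5[of b] ij b dvd_square_iff_5[of b] by (auto simp: dvd_eq_mod_eq_0)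
  moreover have "j \<in> {0, 1, 2, 3, 4}"
    unfolding ij[symmetric] using pos_mod_bound[of 5 K] pos_mod_sign[of 5 K] by force
  ultimately have "K mod 5 \<in> {2, 3}" using ij by auto
  then obtain x y z where F: "5 * K = x\<^sup>2 + y\<^sup>2 + 2 * z\<^sup>2 + x * y + x * z + y * z"
    using represented_by_disc_5[OF K(2)] by blast
  define w where "w = - (x + y + z)"
  have F': "10 * K = x\<^sup>2 + y\<^sup>2 + w\<^sup>2 + 3 * (x + y + w)\<^sup>2"
    using F by (simp add: w_def algebra_simps power2_eq_square)
  have "3 * (2 * x + y + z)\<^sup>2 + (3 * y + z)\<^sup>2 = 5 * (12 * K - 4 * z\<^sup>2)"
    using F by (simp add: algebra_simps power2_eq_square)
  hence "5 dvd 3 * (2 * x + y + z)\<^sup>2 + (3 * y + z)\<^sup>2" by simp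
  note * = three_square_plus_square_dvd_5[OF this]
  have xw: "5 dvd x - w" using *(1) by (simp add: w_def algebra_simps)
  have "5 dvd (2 * x + y + z) - (3 * y + z)" by (intro dvd_diff *)
  hence "5 dvd 2 * (x - y)" by (simp add: algebra_simps)
  hence xy: "5 dvd x - y" using prime_dvd_mult_iff[of "5::int" 2 "x - y"] by simp
  have "\<exists>x y w. 10 * K = x\<^sup>2 + y\<^sup>2 + w\<^sup>2 + 3 * (x + y + w)\<^sup>2 \<and> 5 dvd x - w \<and> 5 dvd y - w \<and> even (x - w)"
  proof -
    have yw: "5 dvd y - w" using dvd_diff[OF xw xy] by simp
    have wx: "5 dvd w - x" using xw by (simp add: dvd_diff_commute)
    have yx: "5 dvd y - x" using xy by (simp add: dvd_diff_commute)
    have wy: "5 dvd w - y" using yw by (simp add: dvd_diff_commute)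
    consider "even (x - w)" | "even (x - y)" | "even (y - w)" by auto
    thus ?thesis
    proof cases
      case 1 thus ?thesis using F' xw yw by blast
    next
      case 2
      have "10 * K = x\<^sup>2 + w\<^sup>2 + y\<^sup>2 + 3 * (x + w + y)\<^sup>2" using F' by (simp add: algebra_simps)
      thus ?thesis using 2 xy wy by blast
    next
      case 3
      have "10 * K = y\<^sup>2 + x\<^sup>2 + w\<^sup>2 + 3 * (y + x + w)\<^sup>2" using F' by (simp add: algebra_simps)
      thus ?thesis using 3 xw yw by blast
    qed
  qed
  then obtain x y w where xyw: "10 * K = x\<^sup>2 + y\<^sup>2 + w\<^sup>2 + 3 * (x + y + w)\<^sup>2" "5 dvd x - w" "5 dvd y - w" "even (x - w)"
    by blast
  have "2 * 5 dvd x - w" using xyw(2,4) by (intro divides_mult) auto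
  hence "10 dvd x - w" by simp
  then obtain c where c: "x - w = 10 * c" by blast
  obtain d where d: "y - w = 5 * d" using xyw(3) by blast
  note cd = c d
  \<comment> \<open>Two of \<open>x\<close>, \<open>y\<close>, \<open>w\<close> agree modulo 2; this makes the isometry onto \<open>3 * t\<^sup>2 + 5 * v\<^sup>2 + 10 * u\<^sup>2\<close> integral.\<close>
  define k where "k = w + 4 * c + 2 * d"
  define t v u where "t = k + c - 2 * d" and "v = k + c" and "u = 2 * c - k"
  have x: "x = k + 6 * c - 2 * d" "y = k - 4 * c + 3 * d" "w = k - 4 * c - 2 * d" using cd by (simp_all add: k_def)
  have "10 * (3 * t\<^sup>2 + 5 * v\<^sup>2 + 10 * u\<^sup>2) = 6 * (10 * K)"
    unfolding xyw(1) x t_def v_def u_def by (simp add: algebra_simps power2_eq_square)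
  hence tvu: "3 * t\<^sup>2 + 5 * v\<^sup>2 + 10 * u\<^sup>2 = 6 * K" by simp
  have par: "even (t - v)" by (simp add: t_def v_def)
  have "3 * ((b - t) * (b + t)) = 5 * (v\<^sup>2 + 2 * u\<^sup>2 + b\<^sup>2 - 2 * a)"
    using tvu K(1) by (simp add: algebra_simps power2_eq_square)
  hence "5 dvd 3 * ((b - t) * (b + t))" by simp
  hence "5 dvd b - t \<or> 5 dvd b + t" using prime_dvd_mult_iff[of "5::int"] by simp
  then obtain t' where t': "5 dvd b - t'" "3 * t'\<^sup>2 + 5 * v\<^sup>2 + 10 * u\<^sup>2 = 6 * K" "even (t' - v)"
  proof
    assume "5 dvd b - t" thus ?thesis using that tvu par by blast
  next
    assume "5 dvd b + t"
    hence "5 dvd b - (- t)" by simp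
    moreover have "even (- t - v)" using par by simp
    ultimately show ?thesis using that[of "- t"] tvu by simp
  qed
  then obtain z where z: "b - t' = 5 * z" by blast
  have b': "b = t' + 5 * z" using z by simp
  have "even (b - 3 * z - v)" using t'(3) unfolding b' by simp
  then obtain y where y: "b - 3 * z - v = 2 * y" by blast
  hence v: "v = t' + 2 * z - 2 * y" using b' by simp
  define p where "p = t' + 2 * z - y"
  have "5 * ((p + u)\<^sup>2 + (p - u)\<^sup>2 + 2 * y\<^sup>2 + 6 * z\<^sup>2) = 6 * K + 2 * b\<^sup>2"
    unfolding t'(2)[symmetric] b' v p_def by (simp add: algebra_simps power2_eq_square)
  also have "\<dots> = 5 * (2 * a)" using K(1) by simp
  finally have "(p + u)\<^sup>2 + (p - u)\<^sup>2 + 2 * y\<^sup>2 + 6 * z\<^sup>2 = 2 * a" by simp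
  moreover have "(p + u) + (p - u) + 2 * y + 6 * z = 2 * b" unfolding b' p_def by simp
  ultimately show ?thesis by blast
qed

section \<open>Small numbers\<close>

lemma two_times_p5: "2 * p5 k = k * (3 * k - 1)"
proof -
  have "even (k * (3 * k - 1))" by simp
  thus ?thesis unfolding p5_def by simp
qed

lemma p5_succ: "p5 (k + 1) = p5 k + 3 * k + 1"
  using two_times_p5[of k] two_times_p5[of "k + 1"] by (simp add: algebra_simps)

lemma p5_pred: "p5 (k - 1) = p5 k - 3 * k + 2"
  using two_times_p5[of k] two_times_p5[of "k - 1"] by (simp add: algebra_simps)

lemma p5_nonneg: "k \<ge> 0 \<Longrightarrow> p5 k \<ge> 0"
proof (cases "k = 0")
  case False
  moreover assume "k \<ge> 0"
  ultimately have "2 * p5 k \<ge> 0" unfolding two_times_p5 by simp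
  thus ?thesis by simp
qed (simp add: p5_def)

definition pentagonal_sum :: "int \<Rightarrow> int \<Rightarrow> bool" where
  "pentagonal_sum c n \<longleftrightarrow> (\<exists>w x y z. w \<ge> 0 \<and> x \<ge> 0 \<and> y \<ge> 0 \<and> z \<ge> 0 \<and> n = p5 w + p5 x + 2 * p5 y + c * p5 z)"

text \<open>In the searches below \<open>p\<close>, \<open>q\<close>, \<open>t\<close> carry the pentagonal numbers of index \<open>w\<close>, \<open>x\<close>, \<open>y\<close>.\<close>

function two_pentagonal :: "int \<Rightarrow> int \<Rightarrow> int \<Rightarrow> int \<Rightarrow> int \<Rightarrow> bool" where
  "two_pentagonal m w p x q = (if x < w then False
     else if p + q < m then two_pentagonal m (w + 1) (p + 3 * w + 1) x q
     else if m < p + q then two_pentagonal m w p (x - 1) (q - 3 * x + 2) else True)"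
  by pat_completeness auto
termination by (relation "measure (\<lambda>(m, w, p, x, q). nat (x - w + 1))") auto

text \<open>The test \<open>y < 0\<close> ensures that \<open>t\<close> grows at every recursive
  call, which gives termination.\<close>

function three_pentagonal :: "int \<Rightarrow> int \<Rightarrow> int \<Rightarrow> int \<Rightarrow> int \<Rightarrow> bool" where
  "three_pentagonal m y t x q = (if m < 2 * t \<or> y < 0 then False
     else if two_pentagonal (m - 2 * t) 0 0 x q then True
     else three_pentagonal m (y + 1) (t + 3 * y + 1) x q)"
  by pat_completeness auto
termination by (relation "measure (\<lambda>(m, y, t, x, q). nat (m + 1 - 2 * t))") auto

text \<open>\<open>es\<close> is an increasing list of numbers to skip. \<open>q\<close> is kept at
  a pentagonal number not below \<open>r\<close>, so that \<open>x\<close> is a valid upper end for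
  the search.\<close>

function all_three_pentagonal :: "int \<Rightarrow> int \<Rightarrow> int list \<Rightarrow> int \<Rightarrow> int \<Rightarrow> bool" where
  "all_three_pentagonal hi r es x q = (if hi \<le> r then True else if x < 0 then False
     else if q < r then all_three_pentagonal hi r es (x + 1) (q + 3 * x + 1)
     else if es \<noteq> [] \<and> hd es = r then all_three_pentagonal hi (r + 1) (tl es) x q
     else if three_pentagonal r 0 0 x q then all_three_pentagonal hi (r + 1) es x q else False)"
  by pat_completeness auto
termination by (relation "measure (\<lambda>(hi, r, es, x, q). nat (hi - r) + nat (hi - q))") auto

declare two_pentagonal.simps [simp del] three_pentagonal.simps [simp del] all_three_pentagonal.simps [simp del]

lemma two_pentagonal_sound:
  "two_pentagonal m w p x q \<Longrightarrow> 0 \<le> w \<Longrightarrow> p = p5 w \<Longrightarrow> q = p5 x \<Longrightarrow>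
     \<exists>w x. w \<ge> 0 \<and> x \<ge> 0 \<and> m = p5 w + p5 x"
proof (induction m w p x q rule: two_pentagonal.induct)
  case (1 m w p x q)
  have "\<not> x < w" using "1.prems"(1) by (subst (asm) two_pentagonal.simps) (simp split: if_splits)
  show ?case
  proof (cases "p + q < m")
    case True
    hence "two_pentagonal m (w + 1) (p + 3 * w + 1) x q"
      using "1.prems"(1) by (subst (asm) two_pentagonal.simps) (simp split: if_splits)
    thus ?thesis using "1.IH"(1)[OF \<open>\<not> x < w\<close> True] "1.prems" by (simp add: p5_succ)
  next
    case le: False
    show ?thesis
    proof (cases "m < p + q")
      case True
      hence "two_pentagonal m w p (x - 1) (q - 3 * x + 2)"
        using "1.prems"(1) le by (subst (asm) two_pentagonal.simps) (simp split: if_splits)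
      thus ?thesis using "1.IH"(2)[OF \<open>\<not> x < w\<close> le True] "1.prems" by (simp add: p5_pred)
    next
      case False
      hence "m = p5 w + p5 x" "x \<ge> 0" using le "1.prems" \<open>\<not> x < w\<close> by auto
      thus ?thesis using "1.prems"(2) by blast
    qed
  qed
qed

definition three_rep :: "int \<Rightarrow> bool" where
  "three_rep m \<longleftrightarrow> (\<exists>w x y. w \<ge> 0 \<and> x \<ge> 0 \<and> y \<ge> 0 \<and> m = p5 w + p5 x + 2 * p5 y)"

lemma three_pentagonal_sound:
  "three_pentagonal m y t x q \<Longrightarrow> t = p5 y \<Longrightarrow> q = p5 x \<Longrightarrow> three_rep m"
proof (induction m y t x q rule: three_pentagonal.induct)
  case (1 m y t x q)
  have *: "\<not> (m < 2 * t \<or> y < 0)"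
    using "1.prems"(1) by (subst (asm) three_pentagonal.simps) (simp split: if_splits)
  show ?case
  proof (cases "two_pentagonal (m - 2 * t) 0 0 x q")
    case True
    then obtain w x' where "w \<ge> 0" "x' \<ge> 0" "m - 2 * t = p5 w + p5 x'"
      using two_pentagonal_sound[OF True] "1.prems"(3) by (auto simp: p5_def)
    hence "m = p5 w + p5 x' + 2 * p5 y" using "1.prems"(2) by simp
    moreover have "y \<ge> 0" using * by simp
    ultimately show ?thesis using \<open>w \<ge> 0\<close> \<open>x' \<ge> 0\<close> unfolding three_rep_def by blast
  next
    case False
    hence "three_pentagonal m (y + 1) (t + 3 * y + 1) x q"
      using "1.prems"(1) * by (subst (asm) three_pentagonal.simps) (simp split: if_splits)
    thus ?thesis using "1.IH"[OF * False] "1.prems" by (simp add: p5_succ)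
  qed
qed

lemma all_three_pentagonal_sound:
  "all_three_pentagonal hi r es x q \<Longrightarrow> q = p5 x \<Longrightarrow> r \<le> m \<Longrightarrow> m < hi \<Longrightarrow> m \<notin> set es \<Longrightarrow> three_rep m"
proof (induction hi r es x q rule: all_three_pentagonal.induct)
  case (1 hi r es x q)
  have hi: "\<not> hi \<le> r" using "1.prems" by simp
  have x: "\<not> x < 0" using "1.prems"(1) hi by (subst (asm) all_three_pentagonal.simps) (simp split: if_splits)
  show ?case
  proof (cases "q < r")
    case True
    hence "all_three_pentagonal hi r es (x + 1) (q + 3 * x + 1)"
      using "1.prems"(1) hi x by (subst (asm) all_three_pentagonal.simps) (simp split: if_splits)
    thus ?thesis using "1.IH"(1)[OF hi x True] "1.prems" by (simp add: p5_succ)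
  next
    case qr: False
    show ?thesis
    proof (cases "es \<noteq> [] \<and> hd es = r")
      case True
      hence "all_three_pentagonal hi (r + 1) (tl es) x q"
        using "1.prems"(1) hi x qr by (subst (asm) all_three_pentagonal.simps) (simp split: if_splits)
      moreover have "m \<noteq> r" using True "1.prems"(5) by (metis list.set_sel(1))
      moreover have "m \<notin> set (tl es)" using True "1.prems"(5) by (metis list.set_sel(2))
      ultimately show ?thesis using "1.IH"(2)[OF hi x qr True] "1.prems" by simp
    next
      case es: False
      have "three_pentagonal r 0 0 x q"
        using "1.prems"(1) hi x qr es by (subst (asm) all_three_pentagonal.simps) (auto split: if_splits)
      moreover from this have "all_three_pentagonal hi (r + 1) es x q"
        using "1.prems"(1) hi x qr es by (subst (asm) all_three_pentagonal.simps) (auto split: if_splits)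
      moreover have "three_rep r" using three_pentagonal_sound[OF \<open>three_pentagonal r 0 0 x q\<close>] "1.prems"(2)
        by (simp add: p5_def)
      ultimately show ?thesis using "1.IH"(3)[OF hi x qr es] "1.prems" by (cases "m = r") simp_all
    qed
  qed
qed

lemma three_pentagonal_table_1: "all_three_pentagonal 700 0 [9, 18, 21, 28, 31, 39, 43, 55, 69, 74, 89, 90, 98, 109, 111, 113, 134, 135, 144, 193, 202, 214, 230, 243, 260, 265, 273, 275, 310, 510, 553, 698, 699] 0 0"
  by code_simp

text \<open>The search restarts at the least pentagonal number not below the new lower end, here
  \<open>p5 22 = 715\<close>; the later tables do likewise.\<close>

lemma three_pentagonal_table_2: "all_three_pentagonal 1300 700 [749, 773, 780, 865, 878, 945, 965, 1219] 22 715"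
  by code_simp

lemma three_pentagonal_table_3: "all_three_pentagonal 1750 1300 [1398, 1413] 30 1335"
  by code_simp

lemma three_pentagonal_table_4: "all_three_pentagonal 2150 1750 [] 35 1820"
  by code_simp

lemma three_pentagonal_table_5: "all_three_pentagonal 2450 2150 [2153, 2168, 2335] 39 2262"
  by code_simp

lemma three_pentagonal_table_6: "all_three_pentagonal 2750 2450 [] 41 2501"
  by code_simp

lemma three_pentagonal_table_7: "all_three_pentagonal 3000 2750 [2828] 43 2752"
  by code_simp

text \<open>The numbers below 3000 that are not of the form \<open>p5 w + p5 x + 2 * p5 y\<close>.\<close>

definition three_exceptions :: "int list" where
  "three_exceptions = [9, 18, 21, 28, 31, 39, 43, 55, 69, 74, 89, 90, 98, 109, 111, 113, 134, 135, 144, 193, 202, 214, 230, 243, 260, 265, 273, 275, 310, 510, 553, 698, 699, 749, 773, 780, 865, 878, 945, 965, 1219, 1398, 1413, 2153, 2168, 2335, 2828]"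

lemma three_rep_table:
  assumes "0 \<le> r" "r < 3000" "r \<notin> set three_exceptions"
  shows "three_rep r"
proof -
  have t1: ?thesis if "0 \<le> r" "r < 700"
    using all_three_pentagonal_sound[OF three_pentagonal_table_1 _ that] assms(3)
    by (auto simp: three_exceptions_def p5_def)
  have t2: ?thesis if "700 \<le> r" "r < 1300"
    using all_three_pentagonal_sound[OF three_pentagonal_table_2 _ that] assms(3)
    by (auto simp: three_exceptions_def p5_def)
  have t3: ?thesis if "1300 \<le> r" "r < 1750"
    using all_three_pentagonal_sound[OF three_pentagonal_table_3 _ that] assms(3)
    by (auto simp: three_exceptions_def p5_def)
  have t4: ?thesis if "1750 \<le> r" "r < 2150"
    using all_three_pentagonal_sound[OF three_pentagonal_table_4 _ that] assms(3)
    by (auto simp: three_exceptions_def p5_def)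
  have t5: ?thesis if "2150 \<le> r" "r < 2450"
    using all_three_pentagonal_sound[OF three_pentagonal_table_5 _ that] assms(3)
    by (auto simp: three_exceptions_def p5_def)
  have t6: ?thesis if "2450 \<le> r" "r < 2750"
    using all_three_pentagonal_sound[OF three_pentagonal_table_6 _ that] assms(3)
    by (auto simp: three_exceptions_def p5_def)
  have t7: ?thesis if "2750 \<le> r" "r < 3000"
    using all_three_pentagonal_sound[OF three_pentagonal_table_7 _ that] assms(3)
    by (auto simp: three_exceptions_def p5_def)
  show ?thesis using assms(1,2) t1 t2 t3 t4 t5 t6 t7 by linarith
qed

text \<open>\<open>e\<close>, \<open>e'\<close> and \<open>e + 36 * z - 42\<close> are the
  remainders left by \<open>z\<close>, \<open>z - 1\<close> and \<open>z - 2\<close> when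
  \<open>6 * p5\<close> of these is subtracted. If the first two are exceptional, the third is not,
  except for one pair, where \<open>z = 36\<close>.\<close>

lemma exceptions_fallback:
  assumes "e \<in> set three_exceptions" "e' \<in> set three_exceptions" "e' = e + 18 * z - 12" "18 \<le> z" "z \<le> 88" "e < 18 * z + 6"
  shows "e + 36 * z - 42 < 3000 \<and> (e + 36 * z - 42 \<notin> set three_exceptions \<or> e = 144 \<and> e' = 780)"
proof -
  \<comment> \<open>\<open>z\<close> is eliminated through \<open>18 * z = e' - e + 12\<close>; the
    first three tests translate the bounds on \<open>z\<close> and \<open>e\<close>.\<close>
  define Q where "Q e e' \<longleftrightarrow> (if e' < e + 312 then True else if e + 1572 < e' then True
      else if e' + 18 \<le> 2 * e then True else if (e' - e + 12) mod 18 \<noteq> 0 then True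
      else 2 * e' - e - 18 < 3000 \<and>
        (2 * e' - e - 18 \<notin> set three_exceptions \<or> e = 144 \<and> e' = 780))" for e e' :: int
  have "list_all (\<lambda>e. list_all (Q e) three_exceptions) three_exceptions"
    unfolding Q_def by code_simp
  hence "Q e e'" using assms(1,2) by (simp only: list_all_iff)
  moreover have "\<not> e' < e + 312" "\<not> e + 1572 < e'" "\<not> e' + 18 \<le> 2 * e" "(e' - e + 12) mod 18 = 0"
    using assms(3-6) by auto
  moreover have "e + 36 * z - 42 = 2 * e' - e - 18" using assms(3) by simp
  ultimately show ?thesis unfolding Q_def by (simp only: if_False not_True_eq_False simp_thms)
qed

lemma pentagonal_sum_three_rep: "three_rep (n - c * p5 z) \<Longrightarrow> z \<ge> 0 \<Longrightarrow> pentagonal_sum c n"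
proof -
  assume "three_rep (n - c * p5 z)" "z \<ge> 0"
  then obtain w x y where "w \<ge> 0" "x \<ge> 0" "y \<ge> 0" "n = p5 w + p5 x + 2 * p5 y + c * p5 z"
    unfolding three_rep_def by (metis add_diff_cancel_left' add.commute diff_add_cancel)
  thus ?thesis using \<open>z \<ge> 0\<close> unfolding pentagonal_sum_def by blast
qed

lemma p5_floor:
  assumes "n \<ge> 0"
  obtains z where "z \<ge> 0" "p5 z \<le> n" "n < p5 (z + 1)"
proof -
  have "p5 (int 0) \<le> n" using assms by (simp add: p5_def)
  moreover have "\<forall>k. p5 (int k) \<le> n \<longrightarrow> k < nat n + 2"
  proof (intro allI impI)
    fix k assume k: "p5 (int k) \<le> n"
    show "k < nat n + 2"
    proof (rule ccontr)
      assume "\<not> k < nat n + 2"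
      hence kn: "int k \<ge> n + 2" by linarith
      have "int k * 2 \<le> int k * (3 * int k - 1)" using kn assms by (intro mult_left_mono) auto
      thus False using k kn two_times_p5[of "int k"] by linarith
    qed
  qed
  ultimately obtain k where k: "p5 (int k) \<le> n" "\<forall>j. p5 (int j) \<le> n \<longrightarrow> j \<le> k"
    using ex_has_greatest_nat[of "\<lambda>k. p5 (int k) \<le> n" 0 "\<lambda>k. k" "nat n + 2"] by auto
  have "n < p5 (int k + 1)" using k(2)[rule_format, of "Suc k"] by (force simp: not_le add.commute)
  thus ?thesis using that[of "int k"] k(1) by simp
qed

lemma p5_mono:
  assumes "0 \<le> j" "j \<le> k"
  shows "p5 j \<le> p5 k"
proof (cases "j = 0")
  case True
  thus ?thesis using p5_nonneg[of k] assms by (simp add: p5_def)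
next
  case False
  hence "j * (3 * j - 1) \<le> k * (3 * k - 1)" using assms by (intro mult_mono) auto
  thus ?thesis unfolding two_times_p5[symmetric] by simp
qed

lemma pentagonal_sum_3_small:
  assumes "0 \<le> n" "n < 3000"
  shows "pentagonal_sum 3 n"
proof (cases "n \<in> set three_exceptions")
  case False
  thus ?thesis using pentagonal_sum_three_rep[of n 3 0] three_rep_table assms by (simp add: p5_def)
next
  case True
  have "list_all (\<lambda>e. 3 \<le> e \<and> (e - 3 \<notin> set three_exceptions \<or> 15 \<le> e \<and> e - 15 \<notin> set three_exceptions)) three_exceptions"
    by code_simp
  hence "3 \<le> n \<and> n - 3 \<notin> set three_exceptions \<or> 15 \<le> n \<and> n - 15 \<notin> set three_exceptions"
    using True by (auto simp: list_all_iff)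
  hence "three_rep (n - 3 * p5 1) \<or> three_rep (n - 3 * p5 2)"
    using three_rep_table[of "n - 3"] three_rep_table[of "n - 15"] assms by (auto simp: p5_def)
  thus ?thesis using pentagonal_sum_three_rep[of n 3] by force
qed

text \<open>The greedy \<open>z\<close> leaves a remainder below \<open>18 * z + 6\<close>, within
  the table although \<open>n\<close> goes up to 70000. If it is exceptional, \<open>z\<close> is
  lowered by 1 or 2, which adds \<open>18 * z - 12\<close> and then
  \<open>18 * z - 30\<close>.\<close>

lemma pentagonal_sum_6_small:
  assumes "0 \<le> n" "n < 70000"
  shows "pentagonal_sum 6 n"
proof (cases "n < 3000")
  case True
  show ?thesis
  proof (cases "n \<in> set three_exceptions")
    case False
    thus ?thesis using pentagonal_sum_three_rep[of n 6 0] three_rep_table assms True by (simp add: p5_def)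
  next
    case n: True
    have "list_all (\<lambda>e. 6 \<le> e \<and> e - 6 \<notin> set three_exceptions) three_exceptions" by code_simp
    hence "6 \<le> n \<and> n - 6 \<notin> set three_exceptions" using n by (auto simp: list_all_iff)
    hence "three_rep (n - 6 * p5 1)" using three_rep_table[of "n - 6"] True by (simp add: p5_def)
    thus ?thesis using pentagonal_sum_three_rep[of n 6] by force
  qed
next
  case False
  have "n div 6 \<ge> 0" using assms(1) by simp
  then obtain z where "z \<ge> 0" "p5 z \<le> n div 6" "n div 6 < p5 (z + 1)" by (rule p5_floor)
  hence z: "z \<ge> 0" "6 * p5 z \<le> n" "n < 6 * p5 (z + 1)" by linarith+
  have "z \<ge> 18"
  proof (rule ccontr)
    assume "\<not> z \<ge> 18"
    hence "p5 (z + 1) \<le> p5 18" using z(1) by (intro p5_mono) auto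
    thus False using z(3) False by (simp add: p5_def)
  qed
  moreover have "z \<le> 88"
  proof (rule ccontr)
    assume "\<not> z \<le> 88"
    hence "p5 89 \<le> p5 z" by (intro p5_mono) auto
    thus False using z(2) assms(2) by (simp add: p5_def)
  qed
  moreover define r where "r = n - 6 * p5 z"
  ultimately have r: "0 \<le> r" "r < 18 * z + 6" "18 \<le> z" "z \<le> 88" using z by (simp_all add: p5_succ)
  have r1: "n - 6 * p5 (z - 1) = r + 18 * z - 12" by (simp add: r_def p5_pred)
  have r2: "n - 6 * p5 (z - 2) = r + 36 * z - 42" using p5_pred[of "z - 1"] by (simp add: r_def p5_pred)
  show ?thesis
  proof (cases "r \<in> set three_exceptions")
    case False
    hence "three_rep (n - 6 * p5 z)" using three_rep_table[of r] r unfolding r_def[symmetric] by simp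
    thus ?thesis using pentagonal_sum_three_rep z(1) by blast
  next
    case True
    \<comment> \<open>As \<open>r < 1590\<close>, this gap brings \<open>r\<close> down to at most
      1413, and then the remainder for \<open>z - 1\<close> is at most 2985.\<close>
    have "list_all (\<lambda>e. e \<le> 1413 \<or> 2153 \<le> e) three_exceptions" by code_simp
    hence "r \<le> 1413" using True r by (auto simp: list_all_iff)
    hence bnd: "0 \<le> r + 18 * z - 12" "r + 18 * z - 12 < 3000" using r by simp_all
    show ?thesis
    proof (cases "r + 18 * z - 12 \<in> set three_exceptions")
      case False
      hence "three_rep (n - 6 * p5 (z - 1))" using three_rep_table bnd unfolding r1 by blast
      thus ?thesis using pentagonal_sum_three_rep[of n 6 "z - 1"] r(3) by simp
    next
      case e': True
      have *: "r + 36 * z - 42 < 3000"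
        "r + 36 * z - 42 \<notin> set three_exceptions \<or> r = 144 \<and> r + 18 * z - 12 = 780"
        using exceptions_fallback[OF True e' refl r(3,4,2)] by auto
      show ?thesis
      proof (cases "r + 36 * z - 42 \<in> set three_exceptions")
        case False
        hence "three_rep (n - 6 * p5 (z - 2))"
          using three_rep_table[of "r + 36 * z - 42"] *(1) r unfolding r2 by simp
        thus ?thesis using pentagonal_sum_three_rep[of n 6 "z - 2"] r(3) by simp
      next
        case True
        hence "r = 144" "z = 36" using *(2) by auto
        hence "n - 6 * p5 33 = 1998" by (simp add: r_def p5_def)
        hence "three_rep (n - 6 * p5 33)" using three_rep_table[of 1998] by (simp add: three_exceptions_def)
        thus ?thesis using pentagonal_sum_three_rep[of n 6 33] by simp
      qed
    qed
  qed
qed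

section \<open>Large numbers\<close>

text \<open>\<open>S\<close> is the total weight, \<open>c\<close> the weight of \<open>v\<close>,
  and \<open>cs\<close> is Cauchy-Schwarz for the other variables. A negative \<open>v\<close> would
  raise their weighted sum to at least \<open>b + 1\<close> while lowering their weighted square sum
  to at most \<open>a - c\<close>.\<close>

lemma index_nonneg:
  fixes a b S c v R :: int
  assumes c: "c \<ge> 1" and cs: "(b - c * v)\<^sup>2 \<le> (S - c) * (a - c * v\<^sup>2)" and S: "c \<le> S" "S \<le> a"
    and b: "b \<ge> 0" "(S - 1) * (a - 1) < (b + 1)\<^sup>2"
  shows "v \<ge> 0"
proof (rule ccontr)
  assume "\<not> v \<ge> 0"
  hence v: "v \<le> -1" by simp
  have "1 * 1 \<le> (-v) * (-v)" using v by (intro mult_mono) auto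
  hence v2: "1 \<le> v\<^sup>2" by (simp add: power2_eq_square)
  have "c * v \<le> c * (-1)" using v c by (intro mult_left_mono) auto
  hence "b + 1 \<le> b - c * v" using c by simp
  hence "(b + 1)\<^sup>2 \<le> (b - c * v)\<^sup>2" using b(1) by (intro power_mono) auto
  also have "\<dots> \<le> (S - c) * (a - c * v\<^sup>2)" by (rule cs)
  also have "\<dots> \<le> (S - c) * (a - c)" using v2 c S by (intro mult_left_mono) auto
  also have "\<dots> \<le> (S - 1) * (a - 1)" using c S by (intro mult_mono) auto
  finally show False using b(2) by simp
qed

lemma cauchy_pentagonal:
  fixes a b c n :: int
  assumes c: "c \<ge> 1" and rep: "w\<^sup>2 + x\<^sup>2 + 2 * y\<^sup>2 + c * z\<^sup>2 = a" "w + x + 2 * y + c * z = b"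
    and n: "3 * a = 2 * n + b" and a: "4 + c \<le> a" and b: "b \<ge> 0" "(3 + c) * (a - 1) < (b + 1)\<^sup>2"
  shows "pentagonal_sum c n"
proof -
  have sq: "0 \<le> p * (q - r)\<^sup>2" if "p \<ge> 0" for p q r :: int using that by simp
  \<comment> \<open>Lagrange's identity for the three variables that remain when one is left
    out.\<close>
  have id: "(4 + c - 1) * (a - 1 * w\<^sup>2) - (b - 1 * w)\<^sup>2 = 2 * (x - y)\<^sup>2 + c * (x - z)\<^sup>2 + (2 * c) * (y - z)\<^sup>2"
    "(4 + c - 1) * (a - 1 * x\<^sup>2) - (b - 1 * x)\<^sup>2 = 2 * (w - y)\<^sup>2 + c * (w - z)\<^sup>2 + (2 * c) * (y - z)\<^sup>2"
    "(4 + c - 2) * (a - 2 * y\<^sup>2) - (b - 2 * y)\<^sup>2 = 1 * (w - x)\<^sup>2 + c * (w - z)\<^sup>2 + c * (x - z)\<^sup>2"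
    "(4 + c - c) * (a - c * z\<^sup>2) - (b - c * z)\<^sup>2 = 1 * (w - x)\<^sup>2 + 2 * (w - y)\<^sup>2 + 2 * (x - y)\<^sup>2"
    unfolding rep[symmetric] by (simp_all add: algebra_simps power2_eq_square)
  have cs: "(b - 1 * w)\<^sup>2 \<le> (4 + c - 1) * (a - 1 * w\<^sup>2)" "(b - 1 * x)\<^sup>2 \<le> (4 + c - 1) * (a - 1 * x\<^sup>2)"
    "(b - 2 * y)\<^sup>2 \<le> (4 + c - 2) * (a - 2 * y\<^sup>2)" "(b - c * z)\<^sup>2 \<le> (4 + c - c) * (a - c * z\<^sup>2)"
    using id sq[of 2] sq[of c] sq[of "2 * c"] sq[of 1] c by (smt (verit))+
  have b': "(4 + c - 1) * (a - 1) < (b + 1)\<^sup>2" using b(2) by (simp add: algebra_simps)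
  have nn: "w \<ge> 0" "x \<ge> 0" "y \<ge> 0" "z \<ge> 0"
    using index_nonneg[OF _ cs(1) _ a b(1) b'] index_nonneg[OF _ cs(2) _ a b(1) b']
      index_nonneg[OF _ cs(3) _ a b(1) b'] index_nonneg[OF c cs(4) _ a b(1) b'] c by auto
  have "2 * (p5 w + p5 x + 2 * p5 y + c * p5 z) =
      2 * p5 w + 2 * p5 x + 2 * (2 * p5 y) + c * (2 * p5 z)" by (simp add: algebra_simps)
  also have "\<dots> = 3 * (w\<^sup>2 + x\<^sup>2 + 2 * y\<^sup>2 + c * z\<^sup>2) - (w + x + 2 * y + c * z)"
    unfolding two_times_p5 by (simp add: algebra_simps power2_eq_square)
  also have "\<dots> = 2 * n" unfolding rep using n by simp
  finally have "p5 w + p5 x + 2 * p5 y + c * p5 z = n" by (rule mult_left_cancel[THEN iffD1, rotated]) simp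
  thus ?thesis using nn unfolding pentagonal_sum_def by blast
qed

lemma least_index:
  fixes f :: "nat \<Rightarrow> int"
  assumes "f 0 < N" "\<exists>m. N \<le> f m"
  obtains m where "N \<le> f (Suc m)" "f m < N"
proof -
  define m where "m = (LEAST m. N \<le> f m)"
  have m: "N \<le> f m" unfolding m_def using assms(2) by (rule LeastI_ex)
  hence "m \<noteq> 0" using assms(1) by (metis not_le)
  then obtain k where k: "m = Suc k" using not0_implies_Suc by blast
  have "\<not> N \<le> f k" using not_less_Least[of k "\<lambda>m. N \<le> f m"] k unfolding m_def by simp
  thus ?thesis using that[of k] m k by simp
qed

lemma pentagonal_sum_3:
  assumes "n \<ge> 0"
  shows "pentagonal_sum 3 n"
proof (cases "n < 3000")
  case False
  have "4 * n \<le> (int (nat (4 * n)))\<^sup>2" using False by (simp add: power2_eq_square)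
  hence ex: "\<exists>m. 4 * n \<le> (int m)\<^sup>2" by blast
  \<comment> \<open>With \<open>3 * a = 2 * n + b\<close>, the condition
    \<open>6 * (a - 1) < (b + 1)\<^sup>2\<close> reads \<open>4 * n < b\<^sup>2 + 7\<close>, so it
    holds for every \<open>b > m\<close>.\<close>
  obtain k where k: "4 * n \<le> (int (Suc k))\<^sup>2" "(int k)\<^sup>2 < 4 * n"
    by (rule least_index[of "\<lambda>m. (int m)\<^sup>2" "4 * n", OF _ ex]) (use False in simp_all)
  define m where "m = int k"
  have m: "m\<^sup>2 < 4 * n" "4 * n \<le> (m + 1)\<^sup>2" using k by (simp_all add: m_def add.commute)
  have m100: "m \<ge> 100"
  proof (rule ccontr)
    assume "\<not> m \<ge> 100"
    hence "(m + 1) * (m + 1) \<le> 100 * 100" by (intro mult_mono) (auto simp: m_def)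
    thus False using m(2) False by (simp add: power2_eq_square)
  qed
  define i where "i = (n - (m + 1)) mod 3"
  have i: "0 \<le> i" "i < 3" by (simp_all add: i_def)
  have dvd: "3 dvd n - (m + 1 + i)"
    using dvd_minus_mod[of 3 "n - (m + 1)"] unfolding i_def[symmetric] diff_diff_eq .
  \<comment> \<open>Three candidates cover the classes modulo 3; a multiple of 7 is avoided by
    moving on by 3.\<close>
  obtain b where b: "m + 1 \<le> b" "b \<le> m + 6" "3 dvd n - b" "\<not> 7 dvd b"
  proof (cases "7 dvd m + 1 + i")
    case False
    show ?thesis by (rule that[OF _ _ dvd False]) (use i in simp_all)
  next
    case True
    have "\<not> 7 dvd m + 1 + i + 3" using True by (simp only: dvd_add_right_iff) simp
    moreover have "3 dvd n - (m + 1 + i + 3)"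
      using dvd_diff[OF dvd, of 3] by (simp only: diff_diff_eq) simp
    ultimately show ?thesis by (intro that[of "m + 1 + i + 3"]) (use i in simp_all)
  qed
  obtain j where "n - b = 3 * j" using b(3) by blast
  hence "2 * n + b = 3 * (n - j)" by simp
  then obtain a where a: "2 * n + b = 3 * a" by blast
  have bb: "(m + 1)\<^sup>2 \<le> b\<^sup>2" using b(1) m100 by (intro power_mono) auto
  have even: "even (a - b)" using a by presburger
  have "3 * b\<^sup>2 < 14 * n + 7 * b"
  proof -
    have "b * (3 * b - 7) \<le> (m + 6) * (3 * (m + 6) - 7)" using b m100 by (intro mult_mono) auto
    moreover have "(m + 6) * (3 * (m + 6) - 7) = 3 * m\<^sup>2 + 29 * m + 66"
      "b * (3 * b - 7) = 3 * b\<^sup>2 - 7 * b" by (simp_all add: algebra_simps power2_eq_square)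
    moreover have "100 * m \<le> m\<^sup>2" unfolding power2_eq_square using m100 by (intro mult_right_mono) auto
    ultimately show ?thesis using m(1) m100 by linarith
  qed
  hence lt: "b\<^sup>2 < 7 * a" using a by simp
  obtain w x y z where "w\<^sup>2 + x\<^sup>2 + 2 * y\<^sup>2 + 3 * z\<^sup>2 = a" "w + x + 2 * y + 3 * z = b"
    using quaternary_with_sum_1[OF even b(4) lt] by blast
  moreover have "(3 + 3) * (a - 1) < (b + 1)\<^sup>2"
    using a bb m(2) by (simp add: algebra_simps power2_eq_square)
  ultimately show ?thesis using a False b m100 by (intro cauchy_pentagonal[of 3 w x y z a b n]) auto
qed (use assms pentagonal_sum_3_small in auto)

lemma pentagonal_sum_6:
  assumes "n \<ge> 0"
  shows "pentagonal_sum 6 n"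
proof (cases "n < 70000")
  case False
  \<comment> \<open>Square sum and linear sum are now \<open>2 * a\<close> and \<open>2 * b\<close>
    with \<open>3 * a = n + b\<close>, and \<open>9 * (2 * a - 1) < (2 * b + 1)\<^sup>2\<close> is
    equivalent to \<open>3 * n < f b\<close>.\<close>
  define f where "f m = 2 * m\<^sup>2 - m + 5" for m :: int
  have "3 * n + 1 \<le> f (int (nat (3 * n)))"
  proof -
    have "n * 1 \<le> n * n" using False by (intro mult_left_mono) auto
    moreover have "f (3 * n) = 18 * (n * n) - 3 * n + 5" by (simp add: f_def power2_eq_square)
    ultimately have "3 * n + 1 \<le> f (3 * n)" using False by linarith
    moreover have "int (nat (3 * n)) = 3 * n" using False by simp
    ultimately show ?thesis by (simp only:)
  qed
  hence ex: "\<exists>m. 3 * n + 1 \<le> f (int m)" by blast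
  obtain k where k: "3 * n + 1 \<le> f (int (Suc k))" "f (int k) < 3 * n + 1"
    by (rule least_index[of "\<lambda>m. f (int m)" "3 * n + 1", OF _ ex]) (use False in \<open>simp_all add: f_def\<close>)
  define m where "m = int k"
  have m: "f m \<le> 3 * n" "3 * n < f (m + 1)" using k by (simp_all add: m_def add.commute)
  \<comment> \<open>323 is the least \<open>m\<close> for which
    \<open>3 * m\<^sup>2 + 103 * m + 882 < 5 * n\<close> below follows from
    \<open>f m \<le> 3 * n\<close>.\<close>
  have m323: "m \<ge> 323"
  proof (rule ccontr)
    assume "\<not> m \<ge> 323"
    hence "(m + 1) * (2 * (m + 1) - 1) \<le> 323 * (2 * 323 - 1)" by (intro mult_mono) (auto simp: m_def)
    thus False using m(2) False by (simp add: f_def algebra_simps power2_eq_square)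
  qed
  \<comment> \<open>The choice \<open>b = 6 * n\<^sup>2 - n (mod 9)\<close> makes \<open>5 * a - b\<^sup>2\<close> divisible by 3.\<close>
  define i where "i = (6 * n\<^sup>2 - n - (m + 1)) mod 9"
  have i: "0 \<le> i" "i < 9" by (simp_all add: i_def)
  have dvd: "9 dvd 6 * n\<^sup>2 - n - (m + 1 + i)"
    using dvd_minus_mod[of 9 "6 * n\<^sup>2 - n - (m + 1)"]
    unfolding i_def[symmetric] diff_diff_eq[of "6 * n\<^sup>2 - n"] .
  obtain b where b: "m + 1 \<le> b" "b \<le> m + 18" "9 dvd 6 * n\<^sup>2 - n - b" "\<not> 5 dvd b"
  proof (cases "5 dvd m + 1 + i")
    case False
    show ?thesis by (rule that[OF _ _ dvd False]) (use i in simp_all)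
  next
    case True
    have "\<not> 5 dvd m + 1 + i + 9" using True by (simp only: dvd_add_right_iff) simp
    moreover have "6 * n\<^sup>2 - n - (m + 1 + i + 9) = 6 * n\<^sup>2 - n - (m + 1 + i) - 9" by simp
    hence "9 dvd 6 * n\<^sup>2 - n - (m + 1 + i + 9)" using dvd_diff[OF dvd dvd_refl] by (simp only:)
    ultimately show ?thesis by (intro that[of "m + 1 + i + 9"]) (use i in simp_all)
  qed
  obtain j where "6 * n\<^sup>2 - n - b = 9 * j" using b(3) by blast
  hence bj: "b = 6 * n\<^sup>2 - n - 9 * j" by simp
  define a where "a = 2 * n\<^sup>2 - 3 * j"
  have a: "n + b = 3 * a" by (simp add: a_def bj)
  define K where "K = 3 * n\<^sup>2 - 5 * j - 12 * n\<^sup>2 * n\<^sup>2 + 4 * n * n\<^sup>2 + 36 * j * n\<^sup>2 - 6 * j * n - 27 * j\<^sup>2"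
  have K: "5 * a - b\<^sup>2 = 3 * K" unfolding a_def bj K_def by (simp add: algebra_simps power2_eq_square)
  have "3 * b\<^sup>2 < 5 * n + 5 * b"
  proof -
    have "b * (3 * b - 5) \<le> (m + 18) * (3 * (m + 18) - 5)" using b m323 by (intro mult_mono) auto
    moreover have "(m + 18) * (3 * (m + 18) - 5) = 3 * m\<^sup>2 + 103 * m + 882"
      "b * (3 * b - 5) = 3 * b\<^sup>2 - 5 * b" by (simp_all add: algebra_simps power2_eq_square)
    moreover have "323 * m \<le> m\<^sup>2" unfolding power2_eq_square using m323 by (intro mult_right_mono) auto
    ultimately show ?thesis using m(1) m323 unfolding f_def by linarith
  qed
  hence K0: "K > 0" using a K by simp
  obtain w x y z where "w\<^sup>2 + x\<^sup>2 + 2 * y\<^sup>2 + 6 * z\<^sup>2 = 2 * a" "w + x + 2 * y + 6 * z = 2 * b"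
    using quaternary_with_sum_2[OF K K0 b(4)] by blast
  moreover have "(3 + 6) * (2 * a - 1) < (2 * b + 1)\<^sup>2"
  proof -
    have "(m + 1) * (2 * (m + 1) - 1) \<le> b * (2 * b - 1)" using b(1) m323 by (intro mult_mono) auto
    thus ?thesis using a m(2) by (simp add: f_def algebra_simps power2_eq_square)
  qed
  ultimately show ?thesis using a False b m323
    by (intro cauchy_pentagonal[of 6 w x y z "2 * a" "2 * b" n]) auto
qed (use assms pentagonal_sum_6_small in auto)

theorem theorem1p3:
  fixes \<delta> :: int and n :: int
  assumes "\<delta> \<in> {1, 2}" and "n \<ge> 0"
  shows "\<exists>w x y z. w \<ge> 0 \<and> x \<ge> 0 \<and> y \<ge> 0 \<and> z \<ge> 0 \<and>
           n = p5 w + p5 x + 2 * p5 y + 3 * \<delta> * p5 z"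
proof -
  consider "\<delta> = 1" | "\<delta> = 2" using assms(1) by blast
  thus ?thesis
  proof cases
    case 1
    thus ?thesis using pentagonal_sum_3[OF assms(2)] unfolding pentagonal_sum_def by simp
  next
    case 2
    thus ?thesis using pentagonal_sum_6[OF assms(2)] unfolding pentagonal_sum_def by simp
  qed
qed

end
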